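(* Let $G$, $H$, and $K$ be finite groups, and let $R$ be a commutative ring such that $|H|$ is invertible in $R$. Let $a\in RB(G,H)$ and $b\in RB(H,K)$. Then $$\alpha_{G,K}(a\cdot_H b)=\alpha_{G,H}(a)*_H^\kappa\alpha_{H,K}(b).$$
   Context: A $(G,H)$-biset is a finite set with commuting left $G$-action and right $H$-action; it is identified with a left $G\times H$-set via $(g,h)x=gxh^{-1}$. $B(G,H)$ is the Grothendieck group of the category of $(G,H)$-bisets with respect to disjoint unions, $[X]$ is the class of $X$, and $RB(G,H)=R\otimes_{\mathbb{Z}}B(G,H)$. For a $(G,H)$-biset $X$ and an $(H,K)$-biset $Y$, $X\times_H Y$ is the $(G,K)$-biset of $H$-orbits of $X\times Y$ under $h(x,y)=(xh^{-1},hy)$, and $-\cdot_H-\colon RB(G,H)\times RB(H,K)\to RB(G,K)$ is the $R$-bilinear map with $[X]\cdot_H[Y]=[X\times_HY]$. For a finite group $X$, $\mathscr{S}_X$ is the set of subgroups of $X$ and $R\mathscr{S}_X$ is the free $R$-module with basis $\mathscr{S}_X$. The $R$-linear map $\alpha_{G,H}\colon RB(G,H)\to R\mathscr{S}_{G\times H}$ is given by $[X]\mapsto\sum_{x\in X}\mathrm{stab}_{G\times H}(x)$. For $L\le G\times H$ put $k_1(L)=\{g\in G\mid (g,1)\in L\}$ and $k_2(L)=\{h\in H\mid(1,h)\in L\}$. For $L\le G\times H$ and $M\le H\times K$ put $L*M=\{(g,k)\in G\times K\mid \exists\,h\in H:\ (g,h)\in L,\ (h,k)\in M\}$. The $R$-bilinear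 map $-*_H^\kappa-\colon R\mathscr{S}_{G\times H}\times R\mathscr{S}_{H\times K}\to R\mathscr{S}_{G\times K}$ is given by $L*_H^\kappa M=\frac{|k_2(L)\cap k_1(M)|}{|H|}\cdot(L*M)$. *)

theory Defs
  imports "HOL-Algebra.Free_Abelian_Groups" "HOL-Algebra.Group_Action" "HOL-Algebra.Generated_Groups" "HOL-Algebra.Module"
begin

section \<open>Bisets\<close>

record ('g, 'h, 'x) biset =
  bset :: "'x set"
  lact :: "'g \<Rightarrow> 'x \<Rightarrow> 'x"
  ract :: "'x \<Rightarrow> 'h \<Rightarrow> 'x"

text \<open>Only the values of the two actions on the carriers are constrained; everything below
  depends on a biset only through those values.\<close>

locale biset =
  fixes G :: "('g, 'm) monoid_scheme" and H :: "('h, 'n) monoid_scheme"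
    and X :: "('g, 'h, 'x) biset"
  assumes finite_bset: "finite (bset X)"
    and lact_closed: "\<lbrakk>g \<in> carrier G; x \<in> bset X\<rbrakk> \<Longrightarrow> lact X g x \<in> bset X"
    and lact_one: "x \<in> bset X \<Longrightarrow> lact X \<one>\<^bsub>G\<^esub> x = x"
    and lact_mult: "\<lbrakk>g \<in> carrier G; g' \<in> carrier G; x \<in> bset X\<rbrakk>
          \<Longrightarrow> lact X (g \<otimes>\<^bsub>G\<^esub> g') x = lact X g (lact X g' x)"
    and ract_closed: "\<lbrakk>h \<in> carrier H; x \<in> bset X\<rbrakk> \<Longrightarrow> ract X x h \<in> bset X"
    and ract_one: "x \<in> bset X \<Longrightarrow> ract X x \<one>\<^bsub>H\<^esub> = x"
    and ract_mult: "\<lbrakk>h \<in> carrier H; h' \<in> carrier H; x \<in> bset X\<rbrakk>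
          \<Longrightarrow> ract X x (h \<otimes>\<^bsub>H\<^esub> h') = ract X (ract X x h) h'"
    and lact_ract: "\<lbrakk>g \<in> carrier G; h \<in> carrier H; x \<in> bset X\<rbrakk>
          \<Longrightarrow> ract X (lact X g x) h = lact X g (ract X x h)"

definition biset_isomorphic ::
  "('g, 'm) monoid_scheme \<Rightarrow> ('h, 'n) monoid_scheme
    \<Rightarrow> ('g, 'h, 'x) biset \<Rightarrow> ('g, 'h, 'y) biset \<Rightarrow> bool" where
  "biset_isomorphic G H X Y \<longleftrightarrow>
     (\<exists>f. bij_betw f (bset X) (bset Y)
        \<and> (\<forall>g\<in>carrier G. \<forall>x\<in>bset X. f (lact X g x) = lact Y g (f x))
        \<and> (\<forall>h\<in>carrier H. \<forall>x\<in>bset X. f (ract X x h) = ract Y (f x) h))"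

definition biset_sum ::
  "('g, 'h, 'x) biset \<Rightarrow> ('g, 'h, 'y) biset \<Rightarrow> ('g, 'h, 'x + 'y) biset" where
  "biset_sum X Y =
     \<lparr> bset = bset X <+> bset Y,
       lact = (\<lambda>g. map_sum (lact X g) (lact Y g)),
       ract = (\<lambda>z h. map_sum (\<lambda>x. ract X x h) (\<lambda>y. ract Y y h) z) \<rparr>"

definition biset_action ::
  "('h, 'n) monoid_scheme \<Rightarrow> ('g, 'h, 'x) biset \<Rightarrow> 'g \<times> 'h \<Rightarrow> 'x \<Rightarrow> 'x" where
  "biset_action H X = (\<lambda>(g, h) x. ract X (lact X g x) (inv\<^bsub>H\<^esub> h))"

definition biset_stab ::
  "('g, 'm) monoid_scheme \<Rightarrow> ('h, 'n) monoid_scheme \<Rightarrow> ('g, 'h, 'x) biset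
    \<Rightarrow> 'x \<Rightarrow> ('g \<times> 'h) set" where
  "biset_stab G H X x = stabilizer (G \<times>\<times> H) (biset_action H X) x"

text \<open>The product over \<open>H\<close>: the \<open>H\<close>-orbits for \<open>h(x, y) = (x h\<inverse>, h y)\<close>, with the actions induced
  elementwise on orbits.\<close>

definition biset_prod ::
  "('h, 'n) monoid_scheme \<Rightarrow> ('g, 'h, 'x) biset \<Rightarrow> ('h, 'k, 'y) biset
    \<Rightarrow> ('g, 'k, ('x \<times> 'y) set) biset" where
  "biset_prod H X Y =
     \<lparr> bset = orbits H (bset X \<times> bset Y)
                (\<lambda>h (x, y). (ract X x (inv\<^bsub>H\<^esub> h), lact Y h y)),
       lact = (\<lambda>g. image (\<lambda>(x, y). (lact X g x, y))),
       ract = (\<lambda>P k. (\<lambda>(x, y). (x, ract Y y k)) ` P) \<rparr>"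


section \<open>Grothendieck group\<close>

text \<open>The abelian group presented by generators \<open>S\<close> and relators \<open>T\<close>, written multiplicatively
  as in \<^theory>\<open>HOL-Algebra.Free_Abelian_Groups\<close>.\<close>

definition ab_pres :: "'a set \<Rightarrow> ('a \<Rightarrow>\<^sub>0 int) set \<Rightarrow> ('a \<Rightarrow>\<^sub>0 int) set monoid" where
  "ab_pres S T = free_Abelian_group S Mod generate (free_Abelian_group S) T"

definition ab_pres_coset :: "'a set \<Rightarrow> ('a \<Rightarrow>\<^sub>0 int) set \<Rightarrow> ('a \<Rightarrow>\<^sub>0 int) \<Rightarrow> ('a \<Rightarrow>\<^sub>0 int) set" where
  "ab_pres_coset S T c = generate (free_Abelian_group S) T #>\<^bsub>free_Abelian_group S\<^esub> c"

text \<open>Every finite biset is isomorphic to one carried by a set of natural numbers, so isomorphism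
  classes are represented inside this universe. The class of a biset may be formed for a biset
  over any type.\<close>

definition biset_class ::
  "('g, 'm) monoid_scheme \<Rightarrow> ('h, 'n) monoid_scheme \<Rightarrow> ('g, 'h, 'x) biset
    \<Rightarrow> ('g, 'h, nat) biset set" where
  "biset_class G H X = {Z. biset G H Z \<and> biset_isomorphic G H X Z}"

definition biset_classes ::
  "('g, 'm) monoid_scheme \<Rightarrow> ('h, 'n) monoid_scheme \<Rightarrow> ('g, 'h, nat) biset set set" where
  "biset_classes G H = {biset_class G H X | (X :: ('g, 'h, nat) biset). biset G H X}"

definition biset_rels ::
  "('g, 'm) monoid_scheme \<Rightarrow> ('h, 'n) monoid_scheme
    \<Rightarrow> (('g, 'h, nat) biset set \<Rightarrow>\<^sub>0 int) set" where
  "biset_rels G H =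
     {frag_of (biset_class G H (biset_sum X Y))
        - frag_of (biset_class G H X) - frag_of (biset_class G H Y)
      | (X :: ('g, 'h, nat) biset) (Y :: ('g, 'h, nat) biset). biset G H X \<and> biset G H Y}"

text \<open>The type of elements of the Grothendieck group of bisets.\<close>

type_synonym ('g, 'h) burnside = "(('g, 'h, nat) biset set \<Rightarrow>\<^sub>0 int) set"

definition burnside_group ::
  "('g, 'm) monoid_scheme \<Rightarrow> ('h, 'n) monoid_scheme \<Rightarrow> ('g, 'h) burnside monoid" where
  "burnside_group G H = ab_pres (biset_classes G H) (biset_rels G H)"

definition burnside_class ::
  "('g, 'm) monoid_scheme \<Rightarrow> ('h, 'n) monoid_scheme \<Rightarrow> ('g, 'h, 'x) biset
    \<Rightarrow> ('g, 'h) burnside" where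
  "burnside_class G H X =
     ab_pres_coset (biset_classes G H) (biset_rels G H) (frag_of (biset_class G H X))"


section \<open>Modules over a commutative ring\<close>

definition lin_map ::
  "('r, 'n) ring_scheme \<Rightarrow> ('r, 'a, 'p) module_scheme \<Rightarrow> ('r, 'b, 'q) module_scheme
    \<Rightarrow> ('a \<Rightarrow> 'b) \<Rightarrow> bool" where
  "lin_map R M N f \<longleftrightarrow>
     f \<in> carrier M \<rightarrow> carrier N
     \<and> (\<forall>x\<in>carrier M. \<forall>y\<in>carrier M. f (x \<oplus>\<^bsub>M\<^esub> y) = f x \<oplus>\<^bsub>N\<^esub> f y)
     \<and> (\<forall>r\<in>carrier R. \<forall>x\<in>carrier M. f (r \<odot>\<^bsub>M\<^esub> x) = r \<odot>\<^bsub>N\<^esub> f x)"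

definition bilin_map ::
  "('r, 'n) ring_scheme \<Rightarrow> ('r, 'a, 'p) module_scheme \<Rightarrow> ('r, 'b, 'q) module_scheme
    \<Rightarrow> ('r, 'c, 's) module_scheme \<Rightarrow> ('a \<times> 'b \<Rightarrow> 'c) \<Rightarrow> bool" where
  "bilin_map R M N P f \<longleftrightarrow>
     (\<forall>y\<in>carrier N. lin_map R M P (\<lambda>x. f (x, y)))
     \<and> (\<forall>x\<in>carrier M. lin_map R N P (\<lambda>y. f (x, y)))"

text \<open>The ring multiplication inherited by the record type \<^typ>\<open>('r, 'a) module\<close> plays no role
  in a module and is left unspecified.\<close>

definition free_module :: "('r, 'n) ring_scheme \<Rightarrow> 's set \<Rightarrow> ('r, 's \<Rightarrow> 'r) module" where
  "free_module R S =
     \<lparr> carrier = {u \<in> S \<rightarrow>\<^sub>E carrier R. finite {s \<in> S. u s \<noteq> \<zero>\<^bsub>R\<^esub>}},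
       mult = undefined, one = undefined,
       zero = (\<lambda>s\<in>S. \<zero>\<^bsub>R\<^esub>),
       add = (\<lambda>u v. \<lambda>s\<in>S. u s \<oplus>\<^bsub>R\<^esub> v s),
       smult = (\<lambda>r u. \<lambda>s\<in>S. r \<otimes>\<^bsub>R\<^esub> u s) \<rparr>"

definition free_basis :: "('r, 'n) ring_scheme \<Rightarrow> 's set \<Rightarrow> 's \<Rightarrow> ('s \<Rightarrow> 'r)" where
  "free_basis R S t = (\<lambda>s\<in>S. if s = t then \<one>\<^bsub>R\<^esub> else \<zero>\<^bsub>R\<^esub>)"

text \<open>Extension of scalars of a (multiplicatively written) abelian group \<open>A\<close> from the integers
  to \<open>R\<close>. The tensor product is the abelian group generated by the pairs \<open>(r, a)\<close> subject to
  biadditivity (which implies that integers can be moved across the tensor sign).\<close>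

definition tensor_gens :: "('r, 'n) ring_scheme \<Rightarrow> ('a, 'm) monoid_scheme \<Rightarrow> ('r \<times> 'a) set" where
  "tensor_gens R A = carrier R \<times> carrier A"

definition tensor_rels ::
  "('r, 'n) ring_scheme \<Rightarrow> ('a, 'm) monoid_scheme \<Rightarrow> (('r \<times> 'a) \<Rightarrow>\<^sub>0 int) set" where
  "tensor_rels R A =
     {frag_of (r \<oplus>\<^bsub>R\<^esub> s, a) - frag_of (r, a) - frag_of (s, a)
      | r s a. r \<in> carrier R \<and> s \<in> carrier R \<and> a \<in> carrier A}
     \<union> {frag_of (r, a \<otimes>\<^bsub>A\<^esub> b) - frag_of (r, a) - frag_of (r, b)
      | r a b. r \<in> carrier R \<and> a \<in> carrier A \<and> b \<in> carrier A}"

text \<open>Scalar multiplication is induced by \<open>(s, a) \<mapsto> (r s, a)\<close>; on a coset it is the union, over its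
  representatives, of the resulting cosets, which are all equal.\<close>

definition scalar_ext ::
  "('r, 'n) ring_scheme \<Rightarrow> ('a, 'm) monoid_scheme
    \<Rightarrow> ('r, (('r \<times> 'a) \<Rightarrow>\<^sub>0 int) set) module" where
  "scalar_ext R A =
     (let T = ab_pres (tensor_gens R A) (tensor_rels R A) in
     \<lparr> carrier = carrier T,
       mult = undefined, one = undefined,
       zero = \<one>\<^bsub>T\<^esub>,
       add = monoid.mult T,
       smult = (\<lambda>r C. \<Union>c\<in>C. ab_pres_coset (tensor_gens R A) (tensor_rels R A)
                   (frag_extend (\<lambda>(s, a). frag_of (r \<otimes>\<^bsub>R\<^esub> s, a)) c)) \<rparr>)"

definition tensor ::
  "('r, 'n) ring_scheme \<Rightarrow> ('a, 'm) monoid_scheme \<Rightarrow> 'r \<Rightarrow> 'a \<Rightarrow> (('r \<times> 'a) \<Rightarrow>\<^sub>0 int) set" where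
  "tensor R A r a = ab_pres_coset (tensor_gens R A) (tensor_rels R A) (frag_of (r, a))"


section \<open>The modules and maps of the statement\<close>

type_synonym ('r, 'g, 'h) rburnside = "(('r \<times> ('g, 'h) burnside) \<Rightarrow>\<^sub>0 int) set"

definition RB ::
  "('r, 'n) ring_scheme \<Rightarrow> ('g, 'm) monoid_scheme \<Rightarrow> ('h, 'p) monoid_scheme
    \<Rightarrow> ('r, ('r, 'g, 'h) rburnside) module" where
  "RB R G H = scalar_ext R (burnside_group G H)"

definition RB_class ::
  "('r, 'n) ring_scheme \<Rightarrow> ('g, 'm) monoid_scheme \<Rightarrow> ('h, 'p) monoid_scheme
    \<Rightarrow> ('g, 'h, 'x) biset \<Rightarrow> ('r, 'g, 'h) rburnside" where
  "RB_class R G H X = tensor R (burnside_group G H) \<one>\<^bsub>R\<^esub> (burnside_class G H X)"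

definition subgroups_of :: "('x, 'm) monoid_scheme \<Rightarrow> 'x set set" where
  "subgroups_of X = {L. subgroup L X}"

definition RS ::
  "('r, 'n) ring_scheme \<Rightarrow> ('x, 'm) monoid_scheme \<Rightarrow> ('r, 'x set \<Rightarrow> 'r) module" where
  "RS R X = free_module R (subgroups_of X)"

definition RS_basis ::
  "('r, 'n) ring_scheme \<Rightarrow> ('x, 'm) monoid_scheme \<Rightarrow> 'x set \<Rightarrow> ('x set \<Rightarrow> 'r)" where
  "RS_basis R X L = free_basis R (subgroups_of X) L"

text \<open>The classes of bisets generate \<^const>\<open>RB\<close> as an \<open>R\<close>-module, so the following two maps are
  determined by their values on such classes. Extensionality fixes the values
  outside the carriers, where they are irrelevant.\<close>

definition biset_comp ::
  "('r, 'n) ring_scheme \<Rightarrow> ('g, 'm) monoid_scheme \<Rightarrow> ('h, 'p) monoid_scheme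
    \<Rightarrow> ('k, 'q) monoid_scheme
    \<Rightarrow> ('r, 'g, 'h) rburnside \<Rightarrow> ('r, 'h, 'k) rburnside \<Rightarrow> ('r, 'g, 'k) rburnside" where
  "biset_comp R G H K = curry (THE f.
     f \<in> extensional (carrier (RB R G H) \<times> carrier (RB R H K))
     \<and> bilin_map R (RB R G H) (RB R H K) (RB R G K) f
     \<and> (\<forall>(X :: ('g, 'h, nat) biset) (Y :: ('h, 'k, nat) biset).
          biset G H X \<longrightarrow> biset H K Y \<longrightarrow>
          f (RB_class R G H X, RB_class R H K Y) = RB_class R G K (biset_prod H X Y)))"

definition alpha ::
  "('r, 'n) ring_scheme \<Rightarrow> ('g, 'm) monoid_scheme \<Rightarrow> ('h, 'p) monoid_scheme
    \<Rightarrow> ('r, 'g, 'h) rburnside \<Rightarrow> (('g \<times> 'h) set \<Rightarrow> 'r)" where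
  "alpha R G H = (THE f.
     f \<in> extensional (carrier (RB R G H))
     \<and> lin_map R (RB R G H) (RS R (G \<times>\<times> H)) f
     \<and> (\<forall>X :: ('g, 'h, nat) biset. biset G H X \<longrightarrow>
          f (RB_class R G H X) =
            (\<Oplus>\<^bsub>RS R (G \<times>\<times> H)\<^esub>x\<in>bset X. RS_basis R (G \<times>\<times> H) (biset_stab G H X x))))"

definition k1 ::
  "('g, 'm) monoid_scheme \<Rightarrow> ('h, 'p) monoid_scheme \<Rightarrow> ('g \<times> 'h) set \<Rightarrow> 'g set" where
  "k1 G H L = {g \<in> carrier G. (g, \<one>\<^bsub>H\<^esub>) \<in> L}"

definition k2 ::
  "('g, 'm) monoid_scheme \<Rightarrow> ('h, 'p) monoid_scheme \<Rightarrow> ('g \<times> 'h) set \<Rightarrow> 'h set" where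
  "k2 G H L = {h \<in> carrier H. (\<one>\<^bsub>G\<^esub>, h) \<in> L}"

definition subgroup_star ::
  "('g, 'm) monoid_scheme \<Rightarrow> ('h, 'p) monoid_scheme \<Rightarrow> ('k, 'q) monoid_scheme
    \<Rightarrow> ('g \<times> 'h) set \<Rightarrow> ('h \<times> 'k) set \<Rightarrow> ('g \<times> 'k) set" where
  "subgroup_star G H K L M =
     {(g, k) \<in> carrier G \<times> carrier K. \<exists>h\<in>carrier H. (g, h) \<in> L \<and> (h, k) \<in> M}"

text \<open>The scalar \<open>|k\<^sub>2(L) \<inter> k\<^sub>1(M)| / |H|\<close>, meaningful when the image of \<open>|H|\<close> in \<open>R\<close> is a unit.\<close>

definition kappa ::
  "('r, 'n) ring_scheme \<Rightarrow> ('g, 'm) monoid_scheme \<Rightarrow> ('h, 'p) monoid_scheme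
    \<Rightarrow> ('k, 'q) monoid_scheme \<Rightarrow> ('g \<times> 'h) set \<Rightarrow> ('h \<times> 'k) set \<Rightarrow> 'r" where
  "kappa R G H K L M =
     ([card (k2 G H L \<inter> k1 H K M)] \<cdot>\<^bsub>R\<^esub> \<one>\<^bsub>R\<^esub>) \<otimes>\<^bsub>R\<^esub> inv\<^bsub>R\<^esub> ([order H] \<cdot>\<^bsub>R\<^esub> \<one>\<^bsub>R\<^esub>)"

text \<open>The bilinear extension of \<open>(L, M) \<mapsto> \<kappa>(L, M) (L * M)\<close>, written out on coordinates.\<close>

definition kappa_star ::
  "('r, 'n) ring_scheme \<Rightarrow> ('g, 'm) monoid_scheme \<Rightarrow> ('h, 'p) monoid_scheme
    \<Rightarrow> ('k, 'q) monoid_scheme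
    \<Rightarrow> (('g \<times> 'h) set \<Rightarrow> 'r) \<Rightarrow> (('h \<times> 'k) set \<Rightarrow> 'r) \<Rightarrow> (('g \<times> 'k) set \<Rightarrow> 'r)" where
  "kappa_star R G H K u v =
     (\<Oplus>\<^bsub>RS R (G \<times>\<times> K)\<^esub>L\<in>subgroups_of (G \<times>\<times> H).
      \<Oplus>\<^bsub>RS R (G \<times>\<times> K)\<^esub>M\<in>subgroups_of (H \<times>\<times> K).
        (u L \<otimes>\<^bsub>R\<^esub> v M) \<odot>\<^bsub>RS R (G \<times>\<times> K)\<^esub>
          (kappa R G H K L M \<odot>\<^bsub>RS R (G \<times>\<times> K)\<^esub>
             RS_basis R (G \<times>\<times> K) (subgroup_star G H K L M)))"

end

theory Submission
  imports Defs
begin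

text \<open>
  Both sides of the asserted equation are bilinear in \<open>a\<close> and \<open>b\<close>, and the classes of bisets span the
  two Burnside modules. So it suffices to treat the classes of a \<open>(G, H)\<close>-biset \<open>X\<close> and an
  \<open>(H, K)\<close>-biset \<open>Y\<close>, where the left-hand side is the sum of the stabilizers of the \<open>H\<close>-orbits on
  \<open>X \<times> Y\<close>, and the right-hand side is a sum over the pairs \<open>(x, y)\<close> themselves. Grouping the pairs by
  orbits compares the two. The stabilizer of the orbit of \<open>(x, y)\<close> in \<open>G \<times> K\<close> is the star product of the
  stabilizers of \<open>x\<close> and \<open>y\<close> (\<open>biset_stab_biset_prod\<close>), and the numerator of the weight \<open>\<kappa>\<close> of this
  pair is the order of its stabilizer in \<open>H\<close>. By the orbit-stabilizer theorem
  (\<open>card_orb_mult_card_stab\<close>) \<open>\<kappa>\<close> is one divided by the length of the orbit, so the pairs in an orbit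
  together contribute the stabilizer of the orbit once (\<open>kappa_star_stab_sum\<close>).

  The larger part of the work is to know that the maps exist. The map \<open>alpha\<close> and the product
  \<open>biset_comp\<close> are the unique linear, respectively bilinear, maps with prescribed values on classes, and
  a unique existence statement must be proved before anything can be said about either. For this the
  Burnside module, a tensor product of \<open>R\<close> with a group given by generators and relators, receives a
  universal property (\<open>RB_lift\<close>, \<open>RB_lin_map_eqI\<close>): linear maps out of it correspond to isomorphism
  invariant, additive functions on bisets. To apply it to the product, it must be known that the product
  of bisets respects isomorphisms and distributes over disjoint sums; all of this follows from a
  characterization of the product as a quotient of \<open>X \<times> Y\<close> (\<open>biset_prod_quotient\<close>).
\<close>

section \<open>Abelian groups given by generators and relators\<close>

locale ab_presentation =
  fixes S :: "'a set" and T :: "('a \<Rightarrow>\<^sub>0 int) set"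
  assumes relators: "c \<in> T \<Longrightarrow> Poly_Mapping.keys c \<subseteq> S"
begin

lemma subgroup_relators: "subgroup (generate (free_Abelian_group S) T) (free_Abelian_group S)"
  by (rule group.generate_is_subgroup) (auto dest: relators)

lemma normal_relators: "generate (free_Abelian_group S) T \<lhd> free_Abelian_group S"
  by (rule comm_group.normal_iff_subgroup[THEN iffD2, OF abelian_free_Abelian_group subgroup_relators])

lemma comm_group_ab_pres: "comm_group (ab_pres S T)"
  unfolding ab_pres_def
  by (rule comm_group.abelian_FactGroup[OF abelian_free_Abelian_group subgroup_relators])

lemma carrier_ab_pres: "carrier (ab_pres S T) = ab_pres_coset S T ` {c. Poly_Mapping.keys c \<subseteq> S}"
  unfolding ab_pres_def ab_pres_coset_def by (auto simp: FactGroup_def RCOSETS_def)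

lemma coset_closed: "Poly_Mapping.keys c \<subseteq> S \<Longrightarrow> ab_pres_coset S T c \<in> carrier (ab_pres S T)"
  by (auto simp: carrier_ab_pres)

lemma coset_add:
  assumes "Poly_Mapping.keys c \<subseteq> S" "Poly_Mapping.keys d \<subseteq> S"
  shows "ab_pres_coset S T (c + d) = ab_pres_coset S T c \<otimes>\<^bsub>ab_pres S T\<^esub> ab_pres_coset S T d"
  using normal.rcos_sum[OF normal_relators, of c d] assms
  by (simp add: ab_pres_def ab_pres_coset_def)

lemma coset_hom: "ab_pres_coset S T \<in> hom (free_Abelian_group S) (ab_pres S T)"
  by (auto intro!: homI simp: coset_add coset_closed)

lemma coset_relator: "c \<in> T \<Longrightarrow> ab_pres_coset S T c = \<one>\<^bsub>ab_pres S T\<^esub>"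
  unfolding ab_pres_def ab_pres_coset_def
  by (simp add: group.coset_join2[OF group_free_Abelian_group _ subgroup_relators] generate.incl relators)

text \<open>In the Burnside group as well as in the tensor product, every relator has the form
  \<open>x - y - z\<close>, that is, it forces one generator to be the sum of two others. This lemma gives
  the relations that hold in the group, and \<open>universal\<close> below gives the maps out of it.\<close>

lemma coset_three_term:
  assumes "frag_of x - frag_of y - frag_of z \<in> T" "x \<in> S" "y \<in> S" "z \<in> S"
  shows "ab_pres_coset S T (frag_of x)
    = ab_pres_coset S T (frag_of y) \<otimes>\<^bsub>ab_pres S T\<^esub> ab_pres_coset S T (frag_of z)"
proof -
  interpret P: comm_group "ab_pres S T" by (rule comm_group_ab_pres)
  have "frag_of x = (frag_of x - frag_of y - frag_of z) + (frag_of y + frag_of z)" by simp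
  then have "ab_pres_coset S T (frag_of x)
      = ab_pres_coset S T ((frag_of x - frag_of y - frag_of z) + (frag_of y + frag_of z))"
    by simp
  also have "\<dots> = ab_pres_coset S T (frag_of x - frag_of y - frag_of z)
      \<otimes>\<^bsub>ab_pres S T\<^esub> ab_pres_coset S T (frag_of y + frag_of z)"
    using assms keys_add[of "frag_of y" "frag_of z"]
    by (intro coset_add) (auto dest: relators)
  also have "\<dots> = ab_pres_coset S T (frag_of y + frag_of z)"
    using assms
    by (simp add: coset_relator P.l_one coset_closed coset_add)
  finally show ?thesis using assms by (simp add: coset_add)
qed

text \<open>The cosets of the generators generate the group. The uniqueness of \<open>alpha\<close> and \<open>biset_comp\<close> rests
  on this.\<close>

lemma hom_eqI:
  assumes "comm_group B" "f \<in> hom (ab_pres S T) B" "g \<in> hom (ab_pres S T) B"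
    and eq: "\<And>s. s \<in> S \<Longrightarrow> f (ab_pres_coset S T (frag_of s)) = g (ab_pres_coset S T (frag_of s))"
    and x: "x \<in> carrier (ab_pres S T)"
  shows "f x = g x"
proof -
  interpret B: comm_group B by fact
  let ?F = "free_Abelian_group S"
  have f: "group_hom ?F B (f \<circ> ab_pres_coset S T)" and g: "group_hom ?F B (g \<circ> ab_pres_coset S T)"
    using assms(2,3) coset_hom hom_compose
    by (auto simp: group_hom_def group_hom_axioms_def)
  obtain c where c: "Poly_Mapping.keys c \<subseteq> S" "x = ab_pres_coset S T c"
    using x by (auto simp: carrier_ab_pres)
  have "(f \<circ> ab_pres_coset S T) c = (g \<circ> ab_pres_coset S T) c"
    using c(1)
  proof (induction c rule: free_Abelian_group_induct[consumes 1, case_names zero diff one])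
    case zero
    show ?case using group_hom.hom_one[OF f] group_hom.hom_one[OF g] by simp
  next
    case (diff a b)
    have "h (a - b) = h a \<otimes>\<^bsub>B\<^esub> inv\<^bsub>B\<^esub> h b" if "group_hom ?F B h" for h
      using diff group_hom.hom_mult[OF that, of a "- b"] group_hom.hom_inv[OF that, of b] by simp
    from this[OF f] this[OF g] diff show ?case by simp
  next
    case (one s)
    then show ?case by (simp add: eq)
  qed
  then show ?thesis by (simp add: c)
qed

lemma lift_hom:
  assumes B: "group B" and h: "h \<in> hom (free_Abelian_group S) B"
    and kill: "\<And>c. c \<in> T \<Longrightarrow> h c = \<one>\<^bsub>B\<^esub>"
  obtains k where "k \<in> hom (ab_pres S T) B"
    and "\<And>c. Poly_Mapping.keys c \<subseteq> S \<Longrightarrow> k (ab_pres_coset S T c) = h c"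
proof -
  interpret group_hom "free_Abelian_group S" B h
    using B h by (simp add: group_hom_def group_hom_axioms_def)
  have "T \<subseteq> kernel (free_Abelian_group S) B h"
    using kill relators by (auto simp: kernel_def)
  then have "generate (free_Abelian_group S) T \<subseteq> kernel (free_Abelian_group S) B h"
    by (rule group.generate_subgroup_incl[OF group_free_Abelian_group _ subgroup_kernel])
  from FactGroup_universal_kernel[OF normal_relators this] show ?thesis
    by (metis ab_pres_def ab_pres_coset_def carrier_free_Abelian_group_iff that)
qed

text \<open>A function on the generators that turns each three-term relator into a true equation extends to
  a homomorphism: extend it over the free group; the extension kills the relators.\<close>

lemma universal:
  assumes "comm_group B" and f: "f ` S \<subseteq> carrier B"
    and rel: "\<And>c. c \<in> T \<Longrightarrow> \<exists>x\<in>S. \<exists>y\<in>S. \<exists>z\<in>S. c = frag_of x - frag_of y - frag_of z \<and> f x = f y \<otimes>\<^bsub>B\<^esub> f z"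
  obtains k where "k \<in> hom (ab_pres S T) B"
    and "\<And>s. s \<in> S \<Longrightarrow> k (ab_pres_coset S T (frag_of s)) = f s"
proof -
  interpret B: comm_group B by fact
  obtain h where h: "h \<in> hom (free_Abelian_group S) B" "\<And>x. x \<in> S \<Longrightarrow> h (frag_of x) = f x"
    using B.free_Abelian_group_universal[OF f] by blast
  interpret h: group_hom "free_Abelian_group S" B h
    using h by (simp add: group_hom_def group_hom_axioms_def B.is_group)
  have "h c = \<one>\<^bsub>B\<^esub>" if "c \<in> T" for c
  proof -
    obtain x y z where xyz: "x \<in> S" "y \<in> S" "z \<in> S" and c: "c = frag_of x - frag_of y - frag_of z"
      and fx: "f x = f y \<otimes>\<^bsub>B\<^esub> f z"
      using rel[OF \<open>c \<in> T\<close>] by blast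
    have [simp]: "f y \<in> carrier B" "f z \<in> carrier B" using f xyz by auto
    have cS: "Poly_Mapping.keys c \<subseteq> S" using relators \<open>c \<in> T\<close> by blast
    have "h (c + (frag_of y + frag_of z)) = h c \<otimes>\<^bsub>B\<^esub> (f y \<otimes>\<^bsub>B\<^esub> f z)"
      using cS xyz keys_add[of "frag_of y" "frag_of z"]
        h.hom_mult[of c "frag_of y + frag_of z"] h.hom_mult[of "frag_of y" "frag_of z"]
      by (auto simp: h(2))
    moreover have "c + (frag_of y + frag_of z) = frag_of x" by (simp add: c)
    moreover have "h c \<in> carrier B" using cS h.hom_closed by simp
    ultimately show ?thesis
      using xyz by (simp add: h(2) fx)
  qed
  from lift_hom[OF B.is_group h(1) this] h(2) show ?thesis
    by (metis frag_of_in_free_Abelian_group carrier_free_Abelian_group_iff that)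
qed

end


section \<open>Extension of scalars\<close>

locale scalar_extension = R?: cring R + A?: comm_group A
  for R :: "('r, 'n) ring_scheme" (structure) and A :: "('a, 'm) monoid_scheme"
begin

sublocale P: ab_presentation "tensor_gens R A" "tensor_rels R A"
proof
  fix c assume "c \<in> tensor_rels R A"
  then obtain x y z where "c = frag_of x - frag_of y - frag_of z"
    and "x \<in> tensor_gens R A" "y \<in> tensor_gens R A" "z \<in> tensor_gens R A"
    unfolding tensor_rels_def tensor_gens_def by force
  moreover have "Poly_Mapping.keys (frag_of x - frag_of y - frag_of z) \<subseteq> {x, y, z}"
    using keys_diff[of "frag_of x - frag_of y" "frag_of z"] keys_diff[of "frag_of x" "frag_of y"]
    by auto
  ultimately show "Poly_Mapping.keys c \<subseteq> tensor_gens R A" by auto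
qed

abbreviation "tensor_group \<equiv> ab_pres (tensor_gens R A) (tensor_rels R A)"

sublocale T: comm_group tensor_group by (rule P.comm_group_ab_pres)

lemma carrier_scalar_ext: "carrier (scalar_ext R A) = carrier tensor_group"
  and add_scalar_ext: "x \<oplus>\<^bsub>scalar_ext R A\<^esub> y = x \<otimes>\<^bsub>tensor_group\<^esub> y"
  and zero_scalar_ext: "\<zero>\<^bsub>scalar_ext R A\<^esub> = \<one>\<^bsub>tensor_group\<^esub>"
  by (simp_all add: scalar_ext_def Let_def)

lemma tensor_closed:
  "\<lbrakk>r \<in> carrier R; a \<in> carrier A\<rbrakk> \<Longrightarrow> tensor R A r a \<in> carrier tensor_group"
  unfolding tensor_def by (rule P.coset_closed) (simp add: tensor_gens_def)

lemma tensor_add_left: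
  assumes "r \<in> carrier R" "s \<in> carrier R" "a \<in> carrier A"
  shows "tensor R A (r \<oplus> s) a = tensor R A r a \<otimes>\<^bsub>tensor_group\<^esub> tensor R A s a"
  unfolding tensor_def
  by (rule P.coset_three_term) (use assms in \<open>auto simp: tensor_gens_def tensor_rels_def\<close>)

lemma tensor_mult_right:
  assumes "r \<in> carrier R" "a \<in> carrier A" "b \<in> carrier A"
  shows "tensor R A r (a \<otimes>\<^bsub>A\<^esub> b) = tensor R A r a \<otimes>\<^bsub>tensor_group\<^esub> tensor R A r b"
  unfolding tensor_def
  by (rule P.coset_three_term) (use assms in \<open>auto simp: tensor_gens_def tensor_rels_def\<close>)

lemma tensor_hom_eqI:
  assumes "comm_group B" "f \<in> hom tensor_group B" "g \<in> hom tensor_group B"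
    and "\<And>r a. \<lbrakk>r \<in> carrier R; a \<in> carrier A\<rbrakk> \<Longrightarrow> f (tensor R A r a) = g (tensor R A r a)"
    and "x \<in> carrier tensor_group"
  shows "f x = g x"
  by (rule P.hom_eqI[OF assms(1-3) _ assms(5)]) (use assms(4) in \<open>auto simp: tensor_gens_def tensor_def\<close>)

lemma tensor_lift:
  assumes "comm_group B" and closed: "\<And>r a. \<lbrakk>r \<in> carrier R; a \<in> carrier A\<rbrakk> \<Longrightarrow> f r a \<in> carrier B"
    and left: "\<And>r s a. \<lbrakk>r \<in> carrier R; s \<in> carrier R; a \<in> carrier A\<rbrakk> \<Longrightarrow> f (r \<oplus> s) a = f r a \<otimes>\<^bsub>B\<^esub> f s a"
    and right: "\<And>r a b. \<lbrakk>r \<in> carrier R; a \<in> carrier A; b \<in> carrier A\<rbrakk>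
        \<Longrightarrow> f r (a \<otimes>\<^bsub>A\<^esub> b) = f r a \<otimes>\<^bsub>B\<^esub> f r b"
  obtains k where "k \<in> hom tensor_group B"
    and "\<And>r a. \<lbrakk>r \<in> carrier R; a \<in> carrier A\<rbrakk> \<Longrightarrow> k (tensor R A r a) = f r a"
proof (rule P.universal[OF assms(1), of "\<lambda>(r, a). f r a"])
  show "(\<lambda>(r, a). f r a) ` tensor_gens R A \<subseteq> carrier B"
    using closed by (auto simp: tensor_gens_def)
next
  fix c assume "c \<in> tensor_rels R A"
  then consider
      (left) r s a where "c = frag_of (r \<oplus> s, a) - frag_of (r, a) - frag_of (s, a)"
        "r \<in> carrier R" "s \<in> carrier R" "a \<in> carrier A"
    | (right) r a b where "c = frag_of (r, a \<otimes>\<^bsub>A\<^esub> b) - frag_of (r, a) - frag_of (r, b)"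
        "r \<in> carrier R" "a \<in> carrier A" "b \<in> carrier A"
    unfolding tensor_rels_def by blast
  then show "\<exists>x\<in>tensor_gens R A. \<exists>y\<in>tensor_gens R A. \<exists>z\<in>tensor_gens R A.
      c = frag_of x - frag_of y - frag_of z
      \<and> (case x of (r, a) \<Rightarrow> f r a) = (case y of (r, a) \<Rightarrow> f r a) \<otimes>\<^bsub>B\<^esub> (case z of (r, a) \<Rightarrow> f r a)"
  proof cases
    case left
    then show ?thesis
      by (intro bexI[of _ "(r \<oplus> s, a)"] bexI[of _ "(r, a)"] bexI[of _ "(s, a)"])
        (auto simp: tensor_gens_def assms(3))
  next
    case right
    then show ?thesis
      by (intro bexI[of _ "(r, a \<otimes>\<^bsub>A\<^esub> b)"] bexI[of _ "(r, a)"] bexI[of _ "(r, b)"])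
        (auto simp: tensor_gens_def assms(4))
  qed
next
  fix k assume k: "k \<in> hom tensor_group B"
    "\<And>s. s \<in> tensor_gens R A \<Longrightarrow> k (ab_pres_coset (tensor_gens R A) (tensor_rels R A) (frag_of s)) = (case s of (r, a) \<Rightarrow> f r a)"
  show thesis
    proof (rule that[OF k(1)])
    show "k (tensor R A r a) = f r a" if "r \<in> carrier R" "a \<in> carrier A" for r a
      using k(2)[of "(r, a)"] that by (simp add: tensor_def tensor_gens_def)
  qed
qed

text \<open>Scalar multiplication is given on a coset as a union over its representatives, so it has to be
  shown that all of them contribute the same coset. The map \<open>(s, a) \<mapsto> (r s) \<otimes> a\<close> is biadditive, so
  it induces an endomorphism \<open>k\<close> of the tensor product by \<open>tensor_lift\<close>. The endomorphism \<open>e\<close> of the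
  free group that appears in the definition of the scalar multiplication covers \<open>k\<close>, whence the coset
  of \<open>e d\<close> depends only on the coset of \<open>d\<close>.\<close>

lemma scalar_ext_smult:
  assumes r: "r \<in> carrier R"
  shows "(\<lambda>C. r \<odot>\<^bsub>scalar_ext R A\<^esub> C) \<in> hom tensor_group tensor_group"
    and "\<And>s a. \<lbrakk>s \<in> carrier R; a \<in> carrier A\<rbrakk>
      \<Longrightarrow> r \<odot>\<^bsub>scalar_ext R A\<^esub> tensor R A s a = tensor R A (r \<otimes> s) a"
proof -
  let ?S = "tensor_gens R A"
  let ?cos = "ab_pres_coset ?S (tensor_rels R A)"
  \<comment> \<open>the endomorphism of the free group from the definition of \<open>scalar_ext\<close>\<close>
  define e :: "('r \<times> 'a \<Rightarrow>\<^sub>0 int) \<Rightarrow> ('r \<times> 'a \<Rightarrow>\<^sub>0 int)"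
    where "e = frag_extend (\<lambda>(s, a). frag_of (r \<otimes> s, a))"
  obtain k where k: "k \<in> hom tensor_group tensor_group"
    and k_tensor: "\<And>s a. \<lbrakk>s \<in> carrier R; a \<in> carrier A\<rbrakk> \<Longrightarrow> k (tensor R A s a) = tensor R A (r \<otimes> s) a"
    by (rule tensor_lift[OF T.comm_group_axioms, of "\<lambda>s a. tensor R A (r \<otimes> s) a"])
      (use r in \<open>auto simp: tensor_closed r_distr tensor_add_left tensor_mult_right\<close>)
  have e_keys: "Poly_Mapping.keys (e c) \<subseteq> ?S" if "Poly_Mapping.keys c \<subseteq> ?S" for c
    using keys_frag_extend[of "\<lambda>(s, a). frag_of (r \<otimes> s, a)" c] that r
    by (fastforce simp: e_def tensor_gens_def)
  have k_coset: "k (?cos c) = ?cos (e c)" if "Poly_Mapping.keys c \<subseteq> ?S" for c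
    using that
  proof (induction c rule: free_Abelian_group_induct[consumes 1, case_names zero diff one])
    case zero
    have "?cos 0 = \<one>\<^bsub>tensor_group\<^esub>"
      using hom_one[OF P.coset_hom group_free_Abelian_group T.is_group] by simp
    then show ?case
      using hom_one[OF k T.is_group T.is_group] by (simp add: e_def)
  next
    case (diff c d)
    have cos_diff: "?cos (u - v) = ?cos u \<otimes>\<^bsub>tensor_group\<^esub> inv\<^bsub>tensor_group\<^esub> ?cos v"
      if "Poly_Mapping.keys u \<subseteq> ?S" "Poly_Mapping.keys v \<subseteq> ?S" for u v
    proof -
      interpret h: group_hom "free_Abelian_group ?S" tensor_group ?cos
        using P.coset_hom by (simp add: group_hom_def group_hom_axioms_def T.is_group)
      show ?thesis using h.hom_mult[of u "- v"] h.hom_inv[of v] that by simp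
    qed
    interpret kh: group_hom tensor_group tensor_group k
      using k by (simp add: group_hom_def group_hom_axioms_def T.is_group)
    show ?case
      using diff e_keys
      by (simp add: cos_diff P.coset_closed e_def frag_extend_diff)
  next
    case (one p)
    then show ?case
      using k_tensor by (auto simp: tensor_gens_def tensor_def e_def)
  qed
  have eq: "r \<odot>\<^bsub>scalar_ext R A\<^esub> C = k C" if C: "C \<in> carrier tensor_group" for C
  proof -
    obtain c where c: "Poly_Mapping.keys c \<subseteq> ?S" "C = ?cos c"
      using C by (auto simp: P.carrier_ab_pres)
    have "?cos (e d) = k C" if "d \<in> ?cos c" for d
    proof -
      have "?cos d = ?cos c" and "Poly_Mapping.keys d \<subseteq> ?S"
        using that c group.repr_independence[OF group_free_Abelian_group _ _ P.subgroup_relators, of d c]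
          monoid.r_coset_subset_G[OF group.is_monoid[OF group_free_Abelian_group] subgroup.subset[OF P.subgroup_relators], of c]
        by (auto simp: ab_pres_coset_def simp flip: carrier_free_Abelian_group_iff)
      then show ?thesis using k_coset[of d] c by simp
    qed
    moreover have "c \<in> ?cos c"
      using group.rcos_self[OF group_free_Abelian_group _ P.subgroup_relators, of c] c
      by (simp add: ab_pres_coset_def)
    ultimately have "(\<Union>d\<in>C. ?cos (e d)) = k C"
      unfolding c(2) by blast
    then show ?thesis by (simp add: scalar_ext_def Let_def e_def)
  qed
  show "(\<lambda>C. r \<odot>\<^bsub>scalar_ext R A\<^esub> C) \<in> hom tensor_group tensor_group"
    using k by (auto simp: hom_def eq Pi_def)
  show "r \<odot>\<^bsub>scalar_ext R A\<^esub> tensor R A s a = tensor R A (r \<otimes> s) a"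
    if "s \<in> carrier R" "a \<in> carrier A" for s a
    using that by (simp add: eq tensor_closed k_tensor)
qed

lemma abelian_group_scalar_ext: "abelian_group (scalar_ext R A)"
proof (rule abelian_groupI)
  fix x assume "x \<in> carrier (scalar_ext R A)"
  then show "\<exists>y\<in>carrier (scalar_ext R A). y \<oplus>\<^bsub>scalar_ext R A\<^esub> x = \<zero>\<^bsub>scalar_ext R A\<^esub>"
    by (intro bexI[of _ "inv\<^bsub>tensor_group\<^esub> x"]) (auto simp: carrier_scalar_ext add_scalar_ext zero_scalar_ext)
qed (simp_all add: carrier_scalar_ext add_scalar_ext zero_scalar_ext T.m_assoc,
    simp add: T.m_comm)

text \<open>Scalar multiplication is additive by \<open>scalar_ext_smult\<close>. In each of the other laws both sides are
  additive in the vector, so it only has to be checked on pure tensors, where it is a ring law in the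
  first factor.\<close>

lemma module_scalar_ext: "module R (scalar_ext R A)"
proof (rule moduleI)
  show "cring R" by (rule R.is_cring)
  show "abelian_group (scalar_ext R A)" by (rule abelian_group_scalar_ext)
  note sm = scalar_ext_smult
  note [simp] = carrier_scalar_ext add_scalar_ext
  fix a x assume a: "a \<in> carrier R" and x: "x \<in> carrier (scalar_ext R A)"
  show "a \<odot>\<^bsub>scalar_ext R A\<^esub> x \<in> carrier (scalar_ext R A)"
    using hom_in_carrier[OF sm(1)[OF a]] x by simp
  show "a \<odot>\<^bsub>scalar_ext R A\<^esub> (x \<oplus>\<^bsub>scalar_ext R A\<^esub> y)
      = a \<odot>\<^bsub>scalar_ext R A\<^esub> x \<oplus>\<^bsub>scalar_ext R A\<^esub> a \<odot>\<^bsub>scalar_ext R A\<^esub> y"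
    if "y \<in> carrier (scalar_ext R A)" for y
    using hom_mult[OF sm(1)[OF a]] x that by simp
  fix b assume b: "b \<in> carrier R"
  show "(a \<oplus> b) \<odot>\<^bsub>scalar_ext R A\<^esub> x
      = a \<odot>\<^bsub>scalar_ext R A\<^esub> x \<oplus>\<^bsub>scalar_ext R A\<^esub> b \<odot>\<^bsub>scalar_ext R A\<^esub> x"
    unfolding add_scalar_ext
  proof (rule tensor_hom_eqI[OF T.comm_group_axioms, where x = x])
    show "(\<lambda>x. (a \<odot>\<^bsub>scalar_ext R A\<^esub> x) \<otimes>\<^bsub>tensor_group\<^esub> (b \<odot>\<^bsub>scalar_ext R A\<^esub> x)) \<in> hom tensor_group tensor_group"
      by (rule T.hom_group_mult) (use a b sm(1) in auto)
  qed (use a b x in \<open>auto simp: sm l_distr tensor_add_left\<close>)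
  show "(a \<otimes> b) \<odot>\<^bsub>scalar_ext R A\<^esub> x = a \<odot>\<^bsub>scalar_ext R A\<^esub> (b \<odot>\<^bsub>scalar_ext R A\<^esub> x)"
  proof (rule tensor_hom_eqI[OF T.comm_group_axioms, where x = x])
    show "(\<lambda>x. a \<odot>\<^bsub>scalar_ext R A\<^esub> (b \<odot>\<^bsub>scalar_ext R A\<^esub> x)) \<in> hom tensor_group tensor_group"
      using Group.hom_compose[OF sm(1)[OF b] sm(1)[OF a]] by (simp add: comp_def)
  qed (use a b x in \<open>auto simp: sm R.m_assoc\<close>)
next
  fix x assume x: "x \<in> carrier (scalar_ext R A)"
  show "\<one> \<odot>\<^bsub>scalar_ext R A\<^esub> x = x"
  proof (rule tensor_hom_eqI[OF T.comm_group_axioms, where x = x and g = "\<lambda>x. x"])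
    show "(\<lambda>x. x) \<in> hom tensor_group tensor_group" by (simp add: hom_def)
  qed (use x in \<open>simp_all add: carrier_scalar_ext scalar_ext_smult\<close>)
qed

lemma lin_map_hom:
  assumes "lin_map R (scalar_ext R A) N f"
  shows "f \<in> hom tensor_group (add_monoid N)"
  using assms by (auto simp: lin_map_def hom_def carrier_scalar_ext add_scalar_ext)

text \<open>Since \<open>r \<otimes> a\<close> is \<open>r\<close> times \<open>1 \<otimes> a\<close>, a linear map is determined by its values on the tensors
  \<open>1 \<otimes> a\<close>.\<close>

lemma scalar_ext_lin_map_eqI:
  assumes N: "module R N" and f: "lin_map R (scalar_ext R A) N f" and g: "lin_map R (scalar_ext R A) N g"
    and eq: "\<And>a. a \<in> carrier A \<Longrightarrow> f (tensor R A \<one> a) = g (tensor R A \<one> a)"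
    and x: "x \<in> carrier (scalar_ext R A)"
  shows "f x = g x"
proof (rule tensor_hom_eqI[where x = x])
  show "comm_group (add_monoid N)"
    using N by (intro abelian_group.a_comm_group) (simp add: module_def)
  fix r a assume r: "r \<in> carrier R" and a: "a \<in> carrier A"
  then have "tensor R A r a = r \<odot>\<^bsub>scalar_ext R A\<^esub> tensor R A \<one> a"
    by (simp add: scalar_ext_smult)
  then show "f (tensor R A r a) = g (tensor R A r a)"
    using f g r a eq tensor_closed[OF R.one_closed a] by (simp add: lin_map_def carrier_scalar_ext)
qed (use assms lin_map_hom in \<open>auto simp: carrier_scalar_ext\<close>)

text \<open>Extension of scalars is left adjoint to restriction: the linear map sends \<open>r \<otimes> a\<close> to \<open>r\<close> times
  \<open>h a\<close>.\<close>

lemma scalar_ext_lift: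
  assumes N: "module R N" and h: "h \<in> hom A (add_monoid N)"
  obtains f where "lin_map R (scalar_ext R A) N f"
    and "\<And>a. a \<in> carrier A \<Longrightarrow> f (tensor R A \<one> a) = h a"
proof -
  interpret N: module R N by fact
  have h_closed: "h a \<in> carrier N" if "a \<in> carrier A" for a
    using h that by (auto simp: hom_def)
  have h_mult: "h (a \<otimes>\<^bsub>A\<^esub> b) = h a \<oplus>\<^bsub>N\<^esub> h b" if "a \<in> carrier A" "b \<in> carrier A" for a b
    using h that by (auto simp: hom_def)
  obtain f where f: "f \<in> hom tensor_group (add_monoid N)"
    and f_tensor: "\<And>r a. \<lbrakk>r \<in> carrier R; a \<in> carrier A\<rbrakk> \<Longrightarrow> f (tensor R A r a) = r \<odot>\<^bsub>N\<^esub> h a"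
    by (rule tensor_lift[OF N.a_comm_group, of "\<lambda>r a. r \<odot>\<^bsub>N\<^esub> h a"])
      (auto simp: h_closed h_mult N.smult_l_distr N.smult_r_distr)
  have "f (r \<odot>\<^bsub>scalar_ext R A\<^esub> x) = r \<odot>\<^bsub>N\<^esub> f x" if r: "r \<in> carrier R" and x: "x \<in> carrier tensor_group" for r x
  proof (rule tensor_hom_eqI[OF N.a_comm_group, where x = x])
    show "(\<lambda>x. f (r \<odot>\<^bsub>scalar_ext R A\<^esub> x)) \<in> hom tensor_group (add_monoid N)"
      using Group.hom_compose[OF scalar_ext_smult(1)[OF r] f] by (simp add: comp_def)
    show "(\<lambda>x. r \<odot>\<^bsub>N\<^esub> f x) \<in> hom tensor_group (add_monoid N)"
      using f r by (auto simp: hom_def N.smult_r_distr Pi_def)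
  qed (use r x in \<open>auto simp: scalar_ext_smult f_tensor h_closed N.smult_assoc1\<close>)
  then have "lin_map R (scalar_ext R A) N f"
    using f by (auto simp: lin_map_def hom_def carrier_scalar_ext add_scalar_ext)
  then show ?thesis
    by (rule that) (simp add: f_tensor h_closed)
qed

end

section \<open>Bisets up to isomorphism\<close>

lemma biset_isomorphicI:
  assumes "bij_betw f (bset X) (bset Y)"
    and "\<And>g x. \<lbrakk>g \<in> carrier G; x \<in> bset X\<rbrakk> \<Longrightarrow> f (lact X g x) = lact Y g (f x)"
    and "\<And>h x. \<lbrakk>h \<in> carrier H; x \<in> bset X\<rbrakk> \<Longrightarrow> f (ract X x h) = ract Y (f x) h"
  shows "biset_isomorphic G H X Y"
  using assms unfolding biset_isomorphic_def by blast

lemma biset_isomorphicE: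
  assumes "biset_isomorphic G H X Y"
  obtains f where "bij_betw f (bset X) (bset Y)"
    and "\<forall>x\<in>bset X. f x \<in> bset Y"
    and "\<forall>g\<in>carrier G. \<forall>x\<in>bset X. f (lact X g x) = lact Y g (f x)"
    and "\<forall>h\<in>carrier H. \<forall>x\<in>bset X. f (ract X x h) = ract Y (f x) h"
proof -
  obtain f where f: "bij_betw f (bset X) (bset Y)"
    and "\<forall>g\<in>carrier G. \<forall>x\<in>bset X. f (lact X g x) = lact Y g (f x)"
    and "\<forall>h\<in>carrier H. \<forall>x\<in>bset X. f (ract X x h) = ract Y (f x) h"
    using assms unfolding biset_isomorphic_def by blast
  then show ?thesis using that bij_betwE[OF f] by blast
qed

lemma biset_isomorphic_refl: "biset_isomorphic G H X X"
  by (rule biset_isomorphicI[of id]) simp_all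

lemma biset_isomorphic_trans:
  assumes "biset_isomorphic G H X Y" "biset_isomorphic G H Y Z"
  shows "biset_isomorphic G H X Z"
proof -
  obtain f where f: "bij_betw f (bset X) (bset Y)"
    "\<forall>x\<in>bset X. f x \<in> bset Y"
    "\<forall>g\<in>carrier G. \<forall>x\<in>bset X. f (lact X g x) = lact Y g (f x)"
    "\<forall>h\<in>carrier H. \<forall>x\<in>bset X. f (ract X x h) = ract Y (f x) h"
    using biset_isomorphicE[OF assms(1)] by blast
  obtain f' where f': "bij_betw f' (bset Y) (bset Z)"
    "\<forall>x\<in>bset Y. f' x \<in> bset Z"
    "\<forall>g\<in>carrier G. \<forall>x\<in>bset Y. f' (lact Y g x) = lact Z g (f' x)"
    "\<forall>h\<in>carrier H. \<forall>x\<in>bset Y. f' (ract Y x h) = ract Z (f' x) h"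
    using biset_isomorphicE[OF assms(2)] by blast
  show ?thesis
    by (rule biset_isomorphicI[OF bij_betw_trans[OF f(1) f'(1)]]) (simp_all add: f f')
qed

lemma biset_isomorphic_sym:
  assumes "biset G H X" "biset_isomorphic G H X Y"
  shows "biset_isomorphic G H Y X"
proof -
  interpret X: biset G H X by fact
  obtain f where f: "bij_betw f (bset X) (bset Y)"
    "\<forall>x\<in>bset X. f x \<in> bset Y"
    "\<forall>g\<in>carrier G. \<forall>x\<in>bset X. f (lact X g x) = lact Y g (f x)"
    "\<forall>h\<in>carrier H. \<forall>x\<in>bset X. f (ract X x h) = ract Y (f x) h"
    using biset_isomorphicE[OF assms(2)] by blast
  define k where "k = inv_into (bset X) f"
  note bij = bij_betw_inv_into[OF f(1), folded k_def]
  have k: "k y \<in> bset X" if "y \<in> bset Y" for y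
    using bij_betwE[OF bij] that by blast
  have fk: "f (k y) = y" if "y \<in> bset Y" for y
    using bij_betw_inv_into_right[OF f(1) that] by (simp add: k_def)
  have kf: "k (f x) = x" if "x \<in> bset X" for x
    using bij_betw_inv_into_left[OF f(1) that] by (simp add: k_def)
  show ?thesis
  proof (rule biset_isomorphicI[OF bij])
    fix g y assume "g \<in> carrier G" "y \<in> bset Y"
    then show "k (lact Y g y) = lact X g (k y)"
      using kf[OF X.lact_closed[OF _ k]] by (simp add: f(3) k fk)
  next
    fix h y assume "h \<in> carrier H" "y \<in> bset Y"
    then show "k (ract Y y h) = ract X (k y) h"
      using kf[OF X.ract_closed[OF _ k]] by (simp add: f(4) k fk)
  qed
qed

lemma biset_transport:
  assumes "biset G H X" and f: "bij_betw f (bset X) B"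
  obtains Z where "bset Z = B" "biset G H Z" "biset_isomorphic G H X Z"
proof -
  interpret X: biset G H X by fact
  define k where "k = inv_into (bset X) f"
  define Z where "Z = \<lparr>bset = B, lact = (\<lambda>a b. f (lact X a (k b))), ract = (\<lambda>b h. f (ract X (k b) h))\<rparr>"
  have k: "k y \<in> bset X" if "y \<in> B" for y
    using bij_betwE[OF bij_betw_inv_into[OF f]] that by (simp add: k_def)
  have fk: "f (k y) = y" if "y \<in> B" for y
    using bij_betw_inv_into_right[OF f that] by (simp add: k_def)
  have kf: "k (f x) = x" if "x \<in> bset X" for x
    using bij_betw_inv_into_left[OF f that] by (simp add: k_def)
  have fB: "f x \<in> B" if "x \<in> bset X" for x
    using bij_betwE[OF f] that by blast
  have "finite B" using bij_betw_finite[OF f] X.finite_bset by simp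
  then have "biset G H Z"
    by (intro biset.intro)
      (simp_all add: Z_def k fk kf fB X.lact_closed X.ract_closed X.lact_one X.ract_one
        X.lact_mult X.ract_mult X.lact_ract)
  moreover have "biset_isomorphic G H X Z"
    by (rule biset_isomorphicI[of f]) (simp_all add: Z_def kf f)
  ultimately show ?thesis using that[of Z] by (simp add: Z_def)
qed

text \<open>This makes the restriction to bisets on natural numbers harmless: classes of bisets over other
  types, such as products and disjoint sums, are classes of bisets on natural numbers.\<close>

lemma biset_nat_copy:
  assumes "biset G H X"
  obtains Z :: "('g, 'h, nat) biset" where "biset G H Z" "biset_isomorphic G H X Z"
proof -
  obtain f where "bij_betw f (bset X) {0..<card (bset X)}"
    using ex_bij_betw_finite_nat[OF biset.finite_bset[OF assms]] by blast
  from biset_transport[OF assms this] that show ?thesis by blast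
qed

lemma biset_class_eq_iff:
  fixes Y :: "('g, 'h, 'y) biset"
  assumes X: "biset G H X" and Y: "biset G H Y"
  shows "biset_class G H X = biset_class G H Y \<longleftrightarrow> biset_isomorphic G H X Y"
proof
  assume eq: "biset_class G H X = biset_class G H Y"
  obtain Z :: "('g, 'h, nat) biset" where Z: "biset G H Z" "biset_isomorphic G H Y Z"
    by (rule biset_nat_copy[OF Y])
  then have "Z \<in> biset_class G H X"
    unfolding eq by (simp add: biset_class_def)
  then show "biset_isomorphic G H X Y"
    unfolding biset_class_def using biset_isomorphic_trans[OF _ biset_isomorphic_sym[OF Y Z(2)]] by blast
next
  assume XY: "biset_isomorphic G H X Y"
  show "biset_class G H X = biset_class G H Y"
    unfolding biset_class_def
    using biset_isomorphic_trans[OF XY] biset_isomorphic_trans[OF biset_isomorphic_sym[OF X XY]]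
    by blast
qed

lemma biset_class_in_classes:
  fixes X :: "('g, 'h, 'x) biset"
  assumes "biset G H X"
  shows "biset_class G H X \<in> biset_classes G H"
proof -
  obtain Z :: "('g, 'h, nat) biset" where Z: "biset G H Z" "biset_isomorphic G H X Z"
    by (rule biset_nat_copy[OF assms])
  then have "biset_class G H X = biset_class G H Z"
    using biset_class_eq_iff[OF assms Z(1)] by blast
  then show ?thesis using Z(1) unfolding biset_classes_def by blast
qed

lemma biset_biset_sum:
  assumes "biset G H X" "biset G H Y"
  shows "biset G H (biset_sum X Y)"
proof -
  interpret X: biset G H X by fact
  interpret Y: biset G H Y by fact
  show ?thesis
    by unfold_locales
      (auto simp: biset_sum_def X.finite_bset Y.finite_bset X.lact_closed X.ract_closed X.lact_one
        X.ract_one X.lact_mult X.ract_mult X.lact_ract Y.lact_closed Y.ract_closed Y.lact_one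
        Y.ract_one Y.lact_mult Y.ract_mult Y.lact_ract)
qed

lemma biset_sum_isomorphic:
  assumes "biset_isomorphic G H X X'" "biset_isomorphic G H Y Y'"
  shows "biset_isomorphic G H (biset_sum X Y) (biset_sum X' Y')"
proof -
  obtain f where f: "bij_betw f (bset X) (bset X')"
    "\<forall>x\<in>bset X. f x \<in> bset X'"
    "\<forall>g\<in>carrier G. \<forall>x\<in>bset X. f (lact X g x) = lact X' g (f x)"
    "\<forall>h\<in>carrier H. \<forall>x\<in>bset X. f (ract X x h) = ract X' (f x) h"
    using biset_isomorphicE[OF assms(1)] by blast
  obtain f' where f': "bij_betw f' (bset Y) (bset Y')"
    "\<forall>x\<in>bset Y. f' x \<in> bset Y'"
    "\<forall>g\<in>carrier G. \<forall>x\<in>bset Y. f' (lact Y g x) = lact Y' g (f' x)"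
    "\<forall>h\<in>carrier H. \<forall>x\<in>bset Y. f' (ract Y x h) = ract Y' (f' x) h"
    using biset_isomorphicE[OF assms(2)] by blast
  have "bij_betw (map_sum f f') (bset X <+> bset Y) (bset X' <+> bset Y')"
  proof (rule bij_betw_imageI)
    show "inj_on (map_sum f f') (bset X <+> bset Y)"
      using inj_on_eq_iff[OF bij_betw_imp_inj_on[OF f(1)]] inj_on_eq_iff[OF bij_betw_imp_inj_on[OF f'(1)]]
      by (intro inj_onI) (elim PlusE; simp)
    have "map_sum f f' ` (bset X <+> bset Y) = f ` bset X <+> f' ` bset Y"
      by (simp add: Plus_def image_Un image_image)
    then show "map_sum f f' ` (bset X <+> bset Y) = bset X' <+> bset Y'"
      using f(1) f'(1) by (simp add: bij_betw_def)
  qed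
  then show ?thesis
    by (intro biset_isomorphicI[of "map_sum f f'"]) (auto simp: biset_sum_def f f')
qed

section \<open>The Burnside module\<close>

lemma ab_presentation_burnside:
  fixes G :: "('g, 'm) monoid_scheme" and H :: "('h, 'p) monoid_scheme"
  shows "ab_presentation (biset_classes G H) (biset_rels G H)"
proof
  fix c assume "c \<in> biset_rels G H"
  then obtain X Y :: "('g, 'h, nat) biset" where
    c: "c = frag_of (biset_class G H (biset_sum X Y))
        - frag_of (biset_class G H X) - frag_of (biset_class G H Y)"
    and XY: "biset G H X" "biset G H Y"
    by (auto simp: biset_rels_def)
  show "Poly_Mapping.keys c \<subseteq> biset_classes G H"
    using XY biset_biset_sum[OF XY] keys_diff unfolding c
    by (intro order_trans[OF keys_diff] Un_least) (auto intro: biset_class_in_classes)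
qed

lemma comm_group_burnside: "comm_group (burnside_group G H)"
  unfolding burnside_group_def by (rule ab_presentation.comm_group_ab_pres[OF ab_presentation_burnside])

lemma burnside_class_closed:
  assumes "biset G H X"
  shows "burnside_class G H X \<in> carrier (burnside_group G H)"
  unfolding burnside_class_def burnside_group_def
  using ab_presentation.coset_closed[OF ab_presentation_burnside] biset_class_in_classes[OF assms]
  by (metis carrier_free_Abelian_group_iff frag_of_in_free_Abelian_group)

lemma burnside_class_iso:
  assumes "biset G H X" "biset G H Y" "biset_isomorphic G H X Y"
  shows "burnside_class G H X = burnside_class G H Y"
  using biset_class_eq_iff[OF assms(1,2)] assms(3) by (simp add: burnside_class_def)

lemma burnside_class_sum:
  fixes X :: "('g, 'h, 'x) biset" and Y :: "('g, 'h, 'y) biset"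
  assumes X: "biset G H X" and Y: "biset G H Y"
  shows "burnside_class G H (biset_sum X Y)
    = burnside_class G H X \<otimes>\<^bsub>burnside_group G H\<^esub> burnside_class G H Y"
proof -
  obtain X' :: "('g, 'h, nat) biset" where X': "biset G H X'" "biset_isomorphic G H X X'"
    by (rule biset_nat_copy[OF X])
  obtain Y' :: "('g, 'h, nat) biset" where Y': "biset G H Y'" "biset_isomorphic G H Y Y'"
    by (rule biset_nat_copy[OF Y])
  have "burnside_class G H (biset_sum X' Y')
    = burnside_class G H X' \<otimes>\<^bsub>burnside_group G H\<^esub> burnside_class G H Y'"
    unfolding burnside_class_def burnside_group_def
  proof (rule ab_presentation.coset_three_term[OF ab_presentation_burnside])
    show "frag_of (biset_class G H (biset_sum X' Y')) - frag_of (biset_class G H X')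
        - frag_of (biset_class G H Y') \<in> biset_rels G H"
      unfolding biset_rels_def using X'(1) Y'(1) by blast
  qed (intro biset_class_in_classes biset_biset_sum X' Y')+
  moreover have "burnside_class G H (biset_sum X Y) = burnside_class G H (biset_sum X' Y')"
    by (intro burnside_class_iso biset_biset_sum biset_sum_isomorphic X Y X' Y')
  ultimately show ?thesis
    using burnside_class_iso[OF X X'] burnside_class_iso[OF Y Y'] by simp
qed

text \<open>The relator for \<open>X\<close> and \<open>Y\<close> involves the class of \<open>biset_sum X Y\<close>, whose carrier does not consist
  of natural numbers. Additivity of \<open>F\<close> is therefore demanded for every \<open>Z\<close> isomorphic to this sum.
  As \<open>F\<close> is constant on isomorphism classes, it gives a function \<open>F'\<close> on the generators.\<close>

lemma burnside_lift:
  fixes F :: "('g, 'h, nat) biset \<Rightarrow> 'b"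
  assumes B: "comm_group B"
    and closed: "\<And>X. biset G H X \<Longrightarrow> F X \<in> carrier B"
    and iso: "\<And>X Y. \<lbrakk>biset G H X; biset G H Y; biset_isomorphic G H X Y\<rbrakk> \<Longrightarrow> F X = F Y"
    and sum: "\<And>X Y Z. \<lbrakk>biset G H X; biset G H Y; biset G H Z; biset_isomorphic G H Z (biset_sum X Y)\<rbrakk>
      \<Longrightarrow> F Z = F X \<otimes>\<^bsub>B\<^esub> F Y"
  obtains k where "k \<in> hom (burnside_group G H) B"
    and "\<And>X. biset G H X \<Longrightarrow> k (burnside_class G H X) = F X"
proof -
  define F' where "F' C = F (SOME X. biset G H X \<and> biset_class G H X = C)" for C
  have F': "F' (biset_class G H X) = F X" if X: "biset G H X" for X :: "('g, 'h, nat) biset"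
  proof -
    let ?Y = "SOME Y :: ('g, 'h, nat) biset. biset G H Y \<and> biset_class G H Y = biset_class G H X"
    have "biset G H ?Y \<and> biset_class G H ?Y = biset_class G H X"
      by (rule someI[of _ X]) (use X in simp)
    then show ?thesis
      unfolding F'_def using X biset_class_eq_iff[of G H ?Y X] iso[of ?Y X] by blast
  qed
  show thesis
  proof (rule ab_presentation.universal[OF ab_presentation_burnside B, of F' G H])
    show "F' ` biset_classes G H \<subseteq> carrier B"
      by (auto simp: biset_classes_def F' closed)
  next
    fix c assume "c \<in> biset_rels G H"
    then obtain X Y :: "('g, 'h, nat) biset" where
      c: "c = frag_of (biset_class G H (biset_sum X Y))
          - frag_of (biset_class G H X) - frag_of (biset_class G H Y)"
      and XY: "biset G H X" "biset G H Y"
      by (auto simp: biset_rels_def)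
    note S = biset_biset_sum[OF XY]
    obtain Z :: "('g, 'h, nat) biset" where Z: "biset G H Z" "biset_isomorphic G H (biset_sum X Y) Z"
      by (rule biset_nat_copy[OF S])
    have "F' (biset_class G H (biset_sum X Y)) = F' (biset_class G H X) \<otimes>\<^bsub>B\<^esub> F' (biset_class G H Y)"
      using sum[OF XY Z(1) biset_isomorphic_sym[OF S Z(2)]] biset_class_eq_iff[OF S Z(1)] Z
      by (simp add: F' XY)
    with c have eq: "c = frag_of (biset_class G H (biset_sum X Y))
          - frag_of (biset_class G H X) - frag_of (biset_class G H Y)
        \<and> F' (biset_class G H (biset_sum X Y)) = F' (biset_class G H X) \<otimes>\<^bsub>B\<^esub> F' (biset_class G H Y)"
      by blast
    show "\<exists>x\<in>biset_classes G H. \<exists>y\<in>biset_classes G H. \<exists>z\<in>biset_classes G H.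
        c = frag_of x - frag_of y - frag_of z \<and> F' x = F' y \<otimes>\<^bsub>B\<^esub> F' z"
      by (intro bexI, rule eq) (intro biset_class_in_classes XY S)+
  next
    fix k assume k: "k \<in> hom (ab_pres (biset_classes G H) (biset_rels G H)) B"
      and eq: "\<And>s. s \<in> biset_classes G H \<Longrightarrow>
        k (ab_pres_coset (biset_classes G H) (biset_rels G H) (frag_of s)) = F' s"
    show thesis
    proof (rule that)
      show "k \<in> hom (burnside_group G H) B" using k by (simp add: burnside_group_def)
      show "k (burnside_class G H X) = F X" if "biset G H X" for X
        using eq[OF biset_class_in_classes[OF that]] that by (simp add: burnside_class_def F')
    qed
  qed
qed

context
  fixes R :: "('r, 'n) ring_scheme" (structure)
  assumes R: "cring R"
begin

lemma scalar_extension_burnside: "scalar_extension R (burnside_group G H)"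
  by (intro scalar_extension.intro R comm_group_burnside)

lemma module_RB: "module R (RB R G H)"
  unfolding RB_def by (rule scalar_extension.module_scalar_ext[OF scalar_extension_burnside])

lemma RB_class_closed:
  assumes "biset G H X"
  shows "RB_class R G H X \<in> carrier (RB R G H)"
  unfolding RB_class_def RB_def scalar_extension.carrier_scalar_ext[OF scalar_extension_burnside]
  by (intro scalar_extension.tensor_closed[OF scalar_extension_burnside] burnside_class_closed assms
      cring.cring_simprules R)

lemma RB_class_iso:
  assumes "biset G H X" "biset G H Y" "biset_isomorphic G H X Y"
  shows "RB_class R G H X = RB_class R G H Y"
  using burnside_class_iso[OF assms] by (simp add: RB_class_def)

lemma RB_class_sum:
  assumes "biset G H X" "biset G H Y"
  shows "RB_class R G H (biset_sum X Y) = RB_class R G H X \<oplus>\<^bsub>RB R G H\<^esub> RB_class R G H Y"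
  unfolding RB_class_def RB_def burnside_class_sum[OF assms]
    scalar_extension.add_scalar_ext[OF scalar_extension_burnside]
  by (intro scalar_extension.tensor_mult_right[OF scalar_extension_burnside] burnside_class_closed
      assms cring.cring_simprules R)

text \<open>The Burnside module is spanned by the classes of bisets on natural numbers.\<close>

lemma RB_lin_map_eqI:
  fixes G :: "('g, 'm) monoid_scheme" and H :: "('h, 'p) monoid_scheme"
  assumes N: "module R N" and f: "lin_map R (RB R G H) N f" and g: "lin_map R (RB R G H) N g"
    and eq: "\<And>X :: ('g, 'h, nat) biset. biset G H X \<Longrightarrow> f (RB_class R G H X) = g (RB_class R G H X)"
    and x: "x \<in> carrier (RB R G H)"
  shows "f x = g x"
proof -
  interpret E: scalar_extension R "burnside_group G H" by (rule scalar_extension_burnside)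
  interpret N: module R N by fact
  let ?t = "tensor R (burnside_group G H) \<one>"
  have t: "?t \<in> hom (burnside_group G H) E.tensor_group"
    by (auto simp: hom_def E.tensor_closed E.tensor_mult_right)
  have "f (?t b) = g (?t b)" if "b \<in> carrier (burnside_group G H)" for b
  proof (rule ab_presentation.hom_eqI[OF ab_presentation_burnside N.a_comm_group,
      where f = "\<lambda>b. f (?t b)" and g = "\<lambda>b. g (?t b)"])
    show "(\<lambda>b. f (?t b)) \<in> hom (ab_pres (biset_classes G H) (biset_rels G H)) (add_monoid N)"
      using Group.hom_compose[OF t E.lin_map_hom[OF f[unfolded RB_def]]]
      by (simp add: burnside_group_def comp_def)
    show "(\<lambda>b. g (?t b)) \<in> hom (ab_pres (biset_classes G H) (biset_rels G H)) (add_monoid N)"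
      using Group.hom_compose[OF t E.lin_map_hom[OF g[unfolded RB_def]]]
      by (simp add: burnside_group_def comp_def)
    show "b \<in> carrier (ab_pres (biset_classes G H) (biset_rels G H))"
      using that by (simp add: burnside_group_def)
  next
    fix s assume "s \<in> biset_classes G H"
    then obtain X :: "('g, 'h, nat) biset" where "biset G H X" "s = biset_class G H X"
      by (auto simp: biset_classes_def)
    then show "f (?t (ab_pres_coset (biset_classes G H) (biset_rels G H) (frag_of s)))
        = g (?t (ab_pres_coset (biset_classes G H) (biset_rels G H) (frag_of s)))"
      using eq[of X] by (simp add: RB_class_def burnside_class_def)
  qed
  then show ?thesis
    using E.scalar_ext_lin_map_eqI[OF N] f g x unfolding RB_def by blast
qed

text \<open>Together with \<open>RB_lin_map_eqI\<close> this is the universal property of the Burnside module: linear maps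
  out of it are the same as functions on bisets that are invariant under isomorphism and additive on
  disjoint sums. Both \<open>alpha\<close> and the product \<open>biset_comp\<close> come from it.\<close>

lemma RB_lift:
  fixes G :: "('g, 'm) monoid_scheme" and H :: "('h, 'p) monoid_scheme"
    and F :: "('g, 'h, nat) biset \<Rightarrow> 'b"
  assumes N: "module R N"
    and closed: "\<And>X. biset G H X \<Longrightarrow> F X \<in> carrier N"
    and iso: "\<And>X Y. \<lbrakk>biset G H X; biset G H Y; biset_isomorphic G H X Y\<rbrakk> \<Longrightarrow> F X = F Y"
    and sum: "\<And>X Y Z. \<lbrakk>biset G H X; biset G H Y; biset G H Z; biset_isomorphic G H Z (biset_sum X Y)\<rbrakk>
      \<Longrightarrow> F Z = F X \<oplus>\<^bsub>N\<^esub> F Y"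
  obtains f where "lin_map R (RB R G H) N f"
    and "\<And>X. biset G H X \<Longrightarrow> f (RB_class R G H X) = F X"
proof -
  interpret E: scalar_extension R "burnside_group G H" by (rule scalar_extension_burnside)
  interpret N: module R N by fact
  obtain k where k: "k \<in> hom (burnside_group G H) (add_monoid N)"
    and kF: "\<And>X. biset G H X \<Longrightarrow> k (burnside_class G H X) = F X"
    by (rule burnside_lift[OF N.a_comm_group, of G H F]) (use closed iso sum in auto)
  obtain f where "lin_map R (RB R G H) N f"
    and f: "\<And>a. a \<in> carrier (burnside_group G H) \<Longrightarrow> f (tensor R (burnside_group G H) \<one> a) = k a"
    using E.scalar_ext_lift[OF N k] unfolding RB_def by blast
  moreover have "f (RB_class R G H X) = F X" if "biset G H X" for X
    using that by (simp add: RB_class_def f burnside_class_closed kF)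
  ultimately show ?thesis using that by blast
qed

end

section \<open>Products of bisets as quotients\<close>

text \<open>The \<open>H\<close>-orbit of \<open>(x, y)\<close> under \<open>h(x, y) = (x h\<inverse>, h y)\<close>, an element of the product of \<open>X\<close> and \<open>Y\<close>.\<close>

definition prod_orbit ::
  "('h, 'p) monoid_scheme \<Rightarrow> ('g, 'h, 'x) biset \<Rightarrow> ('h, 'k, 'y) biset \<Rightarrow> 'x \<Rightarrow> 'y \<Rightarrow> ('x \<times> 'y) set" where
  "prod_orbit H X Y x y = {(ract X x (inv\<^bsub>H\<^esub> h), lact Y h y) | h. h \<in> carrier H}"

locale biset_pair = G?: group G + H?: group H + K?: group K + X?: biset G H X + Y?: biset H K Y
  for G :: "('g, 'm) monoid_scheme" and H :: "('h, 'p) monoid_scheme" (structure)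
    and K :: "('k, 'q) monoid_scheme"
    and X :: "('g, 'h, 'x) biset" and Y :: "('h, 'k, 'y) biset"
begin

abbreviation "orb \<equiv> prod_orbit H X Y"

lemma ract_inv_cancel:
  "\<lbrakk>h \<in> carrier H; x \<in> bset X\<rbrakk> \<Longrightarrow> ract X (ract X x h) (inv h) = x"
  "\<lbrakk>h \<in> carrier H; x \<in> bset X\<rbrakk> \<Longrightarrow> ract X (ract X x (inv h)) h = x"
  using X.ract_mult[of h "inv h" x] X.ract_mult[of "inv h" h x] by (simp_all add: X.ract_one)

lemma lact_inv_cancel:
  "\<lbrakk>h \<in> carrier H; y \<in> bset Y\<rbrakk> \<Longrightarrow> lact Y h (lact Y (inv h) y) = y"
  "\<lbrakk>h \<in> carrier H; y \<in> bset Y\<rbrakk> \<Longrightarrow> lact Y (inv h) (lact Y h y) = y"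
  using Y.lact_mult[of h "inv h" y] Y.lact_mult[of "inv h" h y] by (simp_all add: Y.lact_one)

lemma bset_biset_prod: "bset (biset_prod H X Y) = {orb x y | x y. x \<in> bset X \<and> y \<in> bset Y}"
  by (auto simp: biset_prod_def orbits_def orbit_def prod_orbit_def)

lemma orb_closed: "\<lbrakk>x \<in> bset X; y \<in> bset Y\<rbrakk> \<Longrightarrow> orb x y \<in> bset (biset_prod H X Y)"
  by (auto simp: bset_biset_prod)

lemma orb_subset: "\<lbrakk>x \<in> bset X; y \<in> bset Y\<rbrakk> \<Longrightarrow> orb x y \<subseteq> bset X \<times> bset Y"
  by (auto simp: prod_orbit_def X.ract_closed Y.lact_closed)

lemma orb_refl: "\<lbrakk>x \<in> bset X; y \<in> bset Y\<rbrakk> \<Longrightarrow> (x, y) \<in> orb x y"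
  unfolding prod_orbit_def
  using H.one_closed H.inv_one X.ract_one[of x] Y.lact_one[of y] by (metis (mono_tags, lifting) mem_Collect_eq)

lemma orb_translate_subset:
  assumes "x \<in> bset X" "y \<in> bset Y" "h \<in> carrier H"
  shows "orb (ract X x (inv h)) (lact Y h y) \<subseteq> orb x y"
proof
  fix p assume "p \<in> orb (ract X x (inv h)) (lact Y h y)"
  then obtain h' where h': "h' \<in> carrier H"
    and p: "p = (ract X (ract X x (inv h)) (inv h'), lact Y h' (lact Y h y))"
    by (auto simp: prod_orbit_def)
  have "p = (ract X x (inv (h' \<otimes> h)), lact Y (h' \<otimes> h) y)"
    using assms h' by (simp add: p X.ract_mult[symmetric] Y.lact_mult H.inv_mult_group)
  then show "p \<in> orb x y" using assms h' by (auto simp: prod_orbit_def)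
qed

lemma orb_translate:
  assumes "x \<in> bset X" "y \<in> bset Y" "h \<in> carrier H"
  shows "orb (ract X x (inv h)) (lact Y h y) = orb x y"
proof
  show "orb (ract X x (inv h)) (lact Y h y) \<subseteq> orb x y"
    by (rule orb_translate_subset[OF assms])
  show "orb x y \<subseteq> orb (ract X x (inv h)) (lact Y h y)"
    using orb_translate_subset[of "ract X x (inv h)" "lact Y h y" "inv h"] assms
    by (simp add: X.ract_closed Y.lact_closed ract_inv_cancel lact_inv_cancel)
qed

lemma orb_eq_iff:
  assumes "x \<in> bset X" "y \<in> bset Y" "x' \<in> bset X" "y' \<in> bset Y"
  shows "orb x y = orb x' y' \<longleftrightarrow> (\<exists>h\<in>carrier H. x' = ract X x (inv h) \<and> y' = lact Y h y)"
proof
  assume "orb x y = orb x' y'"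
  then have "(x', y') \<in> orb x y" using orb_refl assms by blast
  then show "\<exists>h\<in>carrier H. x' = ract X x (inv h) \<and> y' = lact Y h y"
    by (auto simp: prod_orbit_def)
qed (use orb_translate assms in auto)

lemma orb_memD:
  assumes "x \<in> bset X" "y \<in> bset Y" "(x', y') \<in> orb x y"
  shows "orb x' y' = orb x y"
proof -
  obtain h where "h \<in> carrier H" "x' = ract X x (inv h)" "y' = lact Y h y"
    using assms(3) by (auto simp: prod_orbit_def)
  then show ?thesis using orb_translate assms(1,2) by simp
qed

lemma lact_biset_prod:
  assumes "g \<in> carrier G" "x \<in> bset X" "y \<in> bset Y"
  shows "lact (biset_prod H X Y) g (orb x y) = orb (lact X g x) y"
  using assms by (auto simp: biset_prod_def prod_orbit_def X.lact_ract image_iff) (metis H.inv_closed X.lact_ract)+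

lemma ract_biset_prod:
  assumes "k \<in> carrier K" "x \<in> bset X" "y \<in> bset Y"
  shows "ract (biset_prod H X Y) (orb x y) k = orb x (ract Y y k)"
  using assms by (auto simp: biset_prod_def prod_orbit_def Y.lact_ract image_iff) (metis Y.lact_ract)+

lemma biset_biset_prod: "biset G K (biset_prod H X Y)"
proof (rule biset.intro)
  have "bset (biset_prod H X Y) \<subseteq> Pow (bset X \<times> bset Y)"
    using orb_subset by (fastforce simp: bset_biset_prod)
  then show "finite (bset (biset_prod H X Y))"
    using X.finite_bset Y.finite_bset finite_subset by blast
qed (auto simp: bset_biset_prod lact_biset_prod ract_biset_prod X.lact_closed Y.ract_closed
    X.lact_one Y.ract_one X.lact_mult Y.ract_mult, (metis X.lact_closed Y.ract_closed)+)

text \<open>The recognition principle for products over \<open>H\<close>: a surjection \<open>q\<close> from the pairs onto a biset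
  \<open>Z\<close> that is equivariant and whose fibres are the \<open>H\<close>-orbits identifies the product with \<open>Z\<close>. It
  reduces the three isomorphisms that follow to writing down \<open>q\<close>.\<close>

lemma biset_prod_quotient:
  assumes Z: "biset G K Z"
    and q: "\<And>x y. \<lbrakk>x \<in> bset X; y \<in> bset Y\<rbrakk> \<Longrightarrow> q x y \<in> bset Z"
    and surj: "\<And>z. z \<in> bset Z \<Longrightarrow> \<exists>x\<in>bset X. \<exists>y\<in>bset Y. z = q x y"
    and fibres: "\<And>x y x' y'. \<lbrakk>x \<in> bset X; y \<in> bset Y; x' \<in> bset X; y' \<in> bset Y\<rbrakk> \<Longrightarrow>
        q x y = q x' y' \<longleftrightarrow> (\<exists>h\<in>carrier H. x' = ract X x (inv h) \<and> y' = lact Y h y)"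
    and left: "\<And>g x y. \<lbrakk>g \<in> carrier G; x \<in> bset X; y \<in> bset Y\<rbrakk> \<Longrightarrow> q (lact X g x) y = lact Z g (q x y)"
    and right: "\<And>k x y. \<lbrakk>k \<in> carrier K; x \<in> bset X; y \<in> bset Y\<rbrakk> \<Longrightarrow> q x (ract Y y k) = ract Z (q x y) k"
  shows "biset_isomorphic G K (biset_prod H X Y) Z"
proof -
  define f where "f P = (THE z. \<exists>x\<in>bset X. \<exists>y\<in>bset Y. P = orb x y \<and> z = q x y)" for P
  have eq_iff: "q x y = q x' y' \<longleftrightarrow> orb x y = orb x' y'"
    if "x \<in> bset X" "y \<in> bset Y" "x' \<in> bset X" "y' \<in> bset Y" for x y x' y'
    using that by (simp add: fibres orb_eq_iff)
  have f: "f (orb x y) = q x y" if "x \<in> bset X" "y \<in> bset Y" for x y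
    unfolding f_def
  proof (rule the_equality)
    fix z assume "\<exists>x'\<in>bset X. \<exists>y'\<in>bset Y. orb x y = orb x' y' \<and> z = q x' y'"
    then show "z = q x y" using eq_iff that by metis
  qed (use that in blast)
  show ?thesis
  proof (rule biset_isomorphicI[of f])
    show "bij_betw f (bset (biset_prod H X Y)) (bset Z)"
    proof (rule bij_betw_imageI)
      show "inj_on f (bset (biset_prod H X Y))"
        by (rule inj_onI) (auto simp: bset_biset_prod f eq_iff)
      show "f ` bset (biset_prod H X Y) = bset Z"
      proof
        show "f ` bset (biset_prod H X Y) \<subseteq> bset Z"
          by (auto simp: bset_biset_prod f q)
        show "bset Z \<subseteq> f ` bset (biset_prod H X Y)"
        proof
          fix z assume "z \<in> bset Z"
          then obtain x y where "x \<in> bset X" "y \<in> bset Y" "z = q x y" using surj by blast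
          then show "z \<in> f ` bset (biset_prod H X Y)"
            by (intro image_eqI[of _ _ "orb x y"]) (auto simp: bset_biset_prod f)
        qed
      qed
    qed
  qed (auto simp: bset_biset_prod lact_biset_prod ract_biset_prod f left right X.lact_closed Y.ract_closed)
qed

end

lemma biset_prod_cong:
  assumes "group G" "group H" "group K" "biset G H X" "biset H K Y" "biset G H X'" "biset H K Y'"
    and XX': "biset_isomorphic G H X X'" and YY': "biset_isomorphic H K Y Y'"
  shows "biset_isomorphic G K (biset_prod H X Y) (biset_prod H X' Y')"
proof -
  interpret XY: biset_pair G H K X Y using assms by (simp add: biset_pair_def)
  interpret XY': biset_pair G H K X' Y' using assms by (simp add: biset_pair_def)
  obtain f where f: "bij_betw f (bset X) (bset X')"
    "\<forall>x\<in>bset X. f x \<in> bset X'"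
    "\<forall>g\<in>carrier G. \<forall>x\<in>bset X. f (lact X g x) = lact X' g (f x)"
    "\<forall>h\<in>carrier H. \<forall>x\<in>bset X. f (ract X x h) = ract X' (f x) h"
    using biset_isomorphicE[OF XX'] by blast
  obtain f' where f': "bij_betw f' (bset Y) (bset Y')"
    "\<forall>x\<in>bset Y. f' x \<in> bset Y'"
    "\<forall>g\<in>carrier H. \<forall>x\<in>bset Y. f' (lact Y g x) = lact Y' g (f' x)"
    "\<forall>h\<in>carrier K. \<forall>x\<in>bset Y. f' (ract Y x h) = ract Y' (f' x) h"
    using biset_isomorphicE[OF YY'] by blast
  note inj = inj_on_eq_iff[OF bij_betw_imp_inj_on[OF f(1)]] inj_on_eq_iff[OF bij_betw_imp_inj_on[OF f'(1)]]
  have surj: "f ` bset X = bset X'" "f' ` bset Y = bset Y'" using f f' by (simp_all add: bij_betw_def)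
  show ?thesis
  proof (rule XY.biset_prod_quotient[OF XY'.biset_biset_prod, of "\<lambda>x y. XY'.orb (f x) (f' y)"])
    fix z assume "z \<in> bset (biset_prod H X' Y')"
    then show "\<exists>x\<in>bset X. \<exists>y\<in>bset Y. z = XY'.orb (f x) (f' y)"
      by (force simp: XY'.bset_biset_prod surj[symmetric])
  next
    fix x y x' y' assume xy: "x \<in> bset X" "y \<in> bset Y" "x' \<in> bset X" "y' \<in> bset Y"
    have "f x' = ract X' (f x) (inv\<^bsub>H\<^esub> h) \<longleftrightarrow> x' = ract X x (inv\<^bsub>H\<^esub> h)" if "h \<in> carrier H" for h
      using xy that f(4) inj(1)[of x' "ract X x (inv\<^bsub>H\<^esub> h)"] XY.X.ract_closed by simp
    moreover have "f' y' = lact Y' h (f' y) \<longleftrightarrow> y' = lact Y h y" if "h \<in> carrier H" for h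
      using xy that f'(3) inj(2)[of y' "lact Y h y"] XY.Y.lact_closed by simp
    ultimately show "XY'.orb (f x) (f' y) = XY'.orb (f x') (f' y') \<longleftrightarrow>
        (\<exists>h\<in>carrier H. x' = ract X x (inv\<^bsub>H\<^esub> h) \<and> y' = lact Y h y)"
      using xy f(2) f'(2) XY'.orb_eq_iff[of "f x" "f' y" "f x'" "f' y'"] by auto
  qed (use f f' in \<open>auto simp: XY'.orb_closed XY'.lact_biset_prod XY'.ract_biset_prod\<close>)
qed

lemma biset_prod_sum_left:
  assumes "group G" "group H" "group K" "biset G H X" "biset G H X'" "biset H K Y"
  shows "biset_isomorphic G K (biset_prod H (biset_sum X X') Y)
    (biset_sum (biset_prod H X Y) (biset_prod H X' Y))"
proof -
  interpret XY: biset_pair G H K X Y using assms by (simp add: biset_pair_def)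
  interpret XY': biset_pair G H K X' Y using assms by (simp add: biset_pair_def)
  interpret S: biset_pair G H K "biset_sum X X'" Y
    using assms by (simp add: biset_pair_def biset_biset_sum)
  have [simp]: "bset (biset_sum X X') = bset X <+> bset X'"
    "\<And>g. lact (biset_sum X X') g = map_sum (lact X g) (lact X' g)"
    "\<And>z h. ract (biset_sum X X') z h = map_sum (\<lambda>x. ract X x h) (\<lambda>y. ract X' y h) z"
    by (simp_all add: biset_sum_def)
  show ?thesis
  proof (rule S.biset_prod_quotient[OF biset_biset_sum[OF XY.biset_biset_prod XY'.biset_biset_prod],
      of "\<lambda>z y. case z of Inl x \<Rightarrow> Inl (XY.orb x y) | Inr x \<Rightarrow> Inr (XY'.orb x y)"])
    fix z assume "z \<in> bset (biset_sum (biset_prod H X Y) (biset_prod H X' Y))"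
    then consider x y where "x \<in> bset X" "y \<in> bset Y" "z = Inl (XY.orb x y)"
      | x y where "x \<in> bset X'" "y \<in> bset Y" "z = Inr (XY'.orb x y)"
      by (auto simp: biset_sum_def XY.bset_biset_prod XY'.bset_biset_prod)
    then show "\<exists>x\<in>bset (biset_sum X X'). \<exists>y\<in>bset Y. z = (case x of Inl x \<Rightarrow> Inl (XY.orb x y) | Inr x \<Rightarrow> Inr (XY'.orb x y))"
    proof cases
      case (1 x y)
      then show ?thesis by (intro bexI[of _ "Inl x"] bexI[of _ y]) auto
    next
      case (2 x y)
      then show ?thesis by (intro bexI[of _ "Inr x"] bexI[of _ y]) auto
    qed
  next
    fix x y x' y'
    assume "x \<in> bset (biset_sum X X')" "y \<in> bset Y" "x' \<in> bset (biset_sum X X')" "y' \<in> bset Y"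
    then show "((case x of Inl x \<Rightarrow> Inl (XY.orb x y) | Inr x \<Rightarrow> Inr (XY'.orb x y))
          = (case x' of Inl x' \<Rightarrow> Inl (XY.orb x' y') | Inr x' \<Rightarrow> Inr (XY'.orb x' y')))
        \<longleftrightarrow> (\<exists>h\<in>carrier H. x' = ract (biset_sum X X') x (inv\<^bsub>H\<^esub> h) \<and> y' = lact Y h y)"
      by (auto simp: XY.orb_eq_iff XY'.orb_eq_iff)
  qed (auto simp: biset_sum_def XY.orb_closed XY'.orb_closed XY.lact_biset_prod
      XY'.lact_biset_prod XY.ract_biset_prod XY'.ract_biset_prod)
qed

lemma biset_prod_sum_right:
  assumes "group G" "group H" "group K" "biset G H X" "biset H K Y" "biset H K Y'"
  shows "biset_isomorphic G K (biset_prod H X (biset_sum Y Y'))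
    (biset_sum (biset_prod H X Y) (biset_prod H X Y'))"
proof -
  interpret XY: biset_pair G H K X Y using assms by (simp add: biset_pair_def)
  interpret XY': biset_pair G H K X Y' using assms by (simp add: biset_pair_def)
  interpret S: biset_pair G H K X "biset_sum Y Y'"
    using assms by (simp add: biset_pair_def biset_biset_sum)
  have [simp]: "bset (biset_sum Y Y') = bset Y <+> bset Y'"
    "\<And>g. lact (biset_sum Y Y') g = map_sum (lact Y g) (lact Y' g)"
    "\<And>z h. ract (biset_sum Y Y') z h = map_sum (\<lambda>x. ract Y x h) (\<lambda>y. ract Y' y h) z"
    by (simp_all add: biset_sum_def)
  show ?thesis
  proof (rule S.biset_prod_quotient[OF biset_biset_sum[OF XY.biset_biset_prod XY'.biset_biset_prod],
      of "\<lambda>x z. case z of Inl y \<Rightarrow> Inl (XY.orb x y) | Inr y \<Rightarrow> Inr (XY'.orb x y)"])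
    fix z assume "z \<in> bset (biset_sum (biset_prod H X Y) (biset_prod H X Y'))"
    then consider x y where "x \<in> bset X" "y \<in> bset Y" "z = Inl (XY.orb x y)"
      | x y where "x \<in> bset X" "y \<in> bset Y'" "z = Inr (XY'.orb x y)"
      by (auto simp: biset_sum_def XY.bset_biset_prod XY'.bset_biset_prod)
    then show "\<exists>x\<in>bset X. \<exists>y\<in>bset (biset_sum Y Y'). z = (case y of Inl y \<Rightarrow> Inl (XY.orb x y) | Inr y \<Rightarrow> Inr (XY'.orb x y))"
    proof cases
      case (1 x y)
      then show ?thesis by (intro bexI[of _ x] bexI[of _ "Inl y"]) auto
    next
      case (2 x y)
      then show ?thesis by (intro bexI[of _ x] bexI[of _ "Inr y"]) auto
    qed
  next
    fix x y x' y'
    assume "x \<in> bset X" "y \<in> bset (biset_sum Y Y')" "x' \<in> bset X" "y' \<in> bset (biset_sum Y Y')"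
    then show "((case y of Inl y \<Rightarrow> Inl (XY.orb x y) | Inr y \<Rightarrow> Inr (XY'.orb x y))
          = (case y' of Inl y' \<Rightarrow> Inl (XY.orb x' y') | Inr y' \<Rightarrow> Inr (XY'.orb x' y')))
        \<longleftrightarrow> (\<exists>h\<in>carrier H. x' = ract X x (inv\<^bsub>H\<^esub> h) \<and> y' = lact (biset_sum Y Y') h y)"
      by (auto simp: XY.orb_eq_iff XY'.orb_eq_iff)
  qed (auto simp: biset_sum_def XY.orb_closed XY'.orb_closed XY.lact_biset_prod
      XY'.lact_biset_prod XY.ract_biset_prod XY'.ract_biset_prod)
qed

section \<open>Linear and bilinear maps\<close>

lemma lin_mapI:
  assumes "\<And>x. x \<in> carrier M \<Longrightarrow> f x \<in> carrier N"
    and "\<And>x y. \<lbrakk>x \<in> carrier M; y \<in> carrier M\<rbrakk> \<Longrightarrow> f (x \<oplus>\<^bsub>M\<^esub> y) = f x \<oplus>\<^bsub>N\<^esub> f y"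
    and "\<And>r x. \<lbrakk>r \<in> carrier R; x \<in> carrier M\<rbrakk> \<Longrightarrow> f (r \<odot>\<^bsub>M\<^esub> x) = r \<odot>\<^bsub>N\<^esub> f x"
  shows "lin_map R M N f"
  using assms by (auto simp: lin_map_def)

lemma lin_mapD:
  assumes "lin_map R M N f"
  shows "x \<in> carrier M \<Longrightarrow> f x \<in> carrier N"
    and "\<lbrakk>x \<in> carrier M; y \<in> carrier M\<rbrakk> \<Longrightarrow> f (x \<oplus>\<^bsub>M\<^esub> y) = f x \<oplus>\<^bsub>N\<^esub> f y"
    and "\<lbrakk>r \<in> carrier R; x \<in> carrier M\<rbrakk> \<Longrightarrow> f (r \<odot>\<^bsub>M\<^esub> x) = r \<odot>\<^bsub>N\<^esub> f x"
  using assms by (auto simp: lin_map_def)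

lemma lin_map_compose:
  assumes "lin_map R M N f" "lin_map R N P g"
  shows "lin_map R M P (\<lambda>x. g (f x))"
  by (rule lin_mapI) (simp_all add: lin_mapD[OF assms(1)] lin_mapD[OF assms(2)])

lemma lin_map_add:
  assumes "module R N" "lin_map R M N f" "lin_map R M N g"
  shows "lin_map R M N (\<lambda>x. f x \<oplus>\<^bsub>N\<^esub> g x)"
proof -
  interpret N: module R N by fact
  show ?thesis
    by (rule lin_mapI)
      (simp_all add: lin_mapD[OF assms(2)] lin_mapD[OF assms(3)] N.M.add.m_ac N.smult_r_distr)
qed

lemma lin_map_smult:
  assumes "module R N" "lin_map R M N f" "r \<in> carrier R"
  shows "lin_map R M N (\<lambda>x. r \<odot>\<^bsub>N\<^esub> f x)"
proof -
  interpret N: module R N by fact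
  show ?thesis
  proof (rule lin_mapI)
    fix s x assume "s \<in> carrier R" "x \<in> carrier M"
    then show "r \<odot>\<^bsub>N\<^esub> f (s \<odot>\<^bsub>M\<^esub> x) = s \<odot>\<^bsub>N\<^esub> (r \<odot>\<^bsub>N\<^esub> f x)"
      using assms(3) by (simp add: lin_mapD[OF assms(2)] N.R.m_comm[of r s] flip: N.smult_assoc1)
  qed (simp_all add: lin_mapD[OF assms(2)] assms(3) N.smult_r_distr)
qed

lemma lin_map_finsum:
  assumes "module R M" "module R N" "lin_map R M N f" "finite A" "\<And>i. i \<in> A \<Longrightarrow> x i \<in> carrier M"
  shows "f (\<Oplus>\<^bsub>M\<^esub>i\<in>A. x i) = (\<Oplus>\<^bsub>N\<^esub>i\<in>A. f (x i))"
proof -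
  interpret M: module R M by fact
  interpret N: module R N by fact
  note f = lin_mapD[OF assms(3)]
  have zero: "f \<zero>\<^bsub>M\<^esub> = \<zero>\<^bsub>N\<^esub>"
    using f(3)[of "\<zero>\<^bsub>R\<^esub>" "\<zero>\<^bsub>M\<^esub>"] f(1)[of "\<zero>\<^bsub>M\<^esub>"] by simp
  show ?thesis
    using assms(4,5)
  proof (induction A rule: finite_induct)
    case empty
    then show ?case by (simp add: zero)
  next
    case (insert a A)
    then have "x \<in> A \<rightarrow> carrier M" "x a \<in> carrier M" by auto
    then show ?case using insert by (simp add: f Pi_def)
  qed
qed

lemma bilin_mapD:
  assumes "bilin_map R M N P f"
  shows "y \<in> carrier N \<Longrightarrow> lin_map R M P (\<lambda>x. f (x, y))"
    and "x \<in> carrier M \<Longrightarrow> lin_map R N P (\<lambda>y. f (x, y))"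
  using assms by (auto simp: bilin_map_def)

lemma RB_bilin_map_eqI:
  fixes G :: "('g, 'm) monoid_scheme" and H :: "('h, 'p) monoid_scheme" and K :: "('k, 'q) monoid_scheme"
  assumes R: "cring R" and P: "module R P"
    and f: "bilin_map R (RB R G H) (RB R H K) P f" and g: "bilin_map R (RB R G H) (RB R H K) P g"
    and eq: "\<And>(X :: ('g, 'h, nat) biset) (Y :: ('h, 'k, nat) biset). \<lbrakk>biset G H X; biset H K Y\<rbrakk>
      \<Longrightarrow> f (RB_class R G H X, RB_class R H K Y) = g (RB_class R G H X, RB_class R H K Y)"
    and a: "a \<in> carrier (RB R G H)" and b: "b \<in> carrier (RB R H K)"
  shows "f (a, b) = g (a, b)"
proof (rule RB_lin_map_eqI[OF R P bilin_mapD(1)[OF f b] bilin_mapD(1)[OF g b] _ a])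
  fix X :: "('g, 'h, nat) biset" assume X: "biset G H X"
  then have cX: "RB_class R G H X \<in> carrier (RB R G H)" by (rule RB_class_closed[OF R])
  show "f (RB_class R G H X, b) = g (RB_class R G H X, b)"
    by (rule RB_lin_map_eqI[OF R P bilin_mapD(2)[OF f cX] bilin_mapD(2)[OF g cX] _ b])
      (rule eq[OF X])
qed

section \<open>The composition product\<close>

text \<open>The product is extended one variable at a time. For a fixed biset \<open>Y\<close>, the class of the product of
  \<open>X\<close> and \<open>Y\<close> is additive in \<open>X\<close> and extends to a linear map \<open>f Y\<close>. For a fixed element \<open>a\<close>, the
  function that sends \<open>Y\<close> to \<open>f Y a\<close> is invariant and additive, because for each of these properties
  the two sides are linear in \<open>a\<close> and agree on classes; hence it extends to a linear map \<open>g a\<close>. That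
  \<open>g a b\<close> is linear in \<open>a\<close> is again checked on classes in the second variable. This existence proof,
  with uniqueness from \<open>RB_bilin_map_eqI\<close>, is what the definite description in \<open>biset_comp\<close> requires.\<close>

lemma biset_comp_spec:
  fixes G :: "('g, 'm) monoid_scheme" and H :: "('h, 'p) monoid_scheme" and K :: "('k, 'q) monoid_scheme"
    and R :: "('r, 'n) ring_scheme"
  assumes R: "cring R" and gr: "group G" "group H" "group K"
  shows "bilin_map R (RB R G H) (RB R H K) (RB R G K) (\<lambda>(a, b). biset_comp R G H K a b)"
    and "\<And>(X :: ('g, 'h, nat) biset) (Y :: ('h, 'k, nat) biset). \<lbrakk>biset G H X; biset H K Y\<rbrakk>
      \<Longrightarrow> biset_comp R G H K (RB_class R G H X) (RB_class R H K Y) = RB_class R G K (biset_prod H X Y)"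
proof -
  note mod = module_RB[OF R]
  have prod: "biset G K (biset_prod H X Y)" if "biset G H X" "biset H K Y"
    for X :: "('g, 'h, 'x) biset" and Y :: "('h, 'k, 'y) biset"
    by (rule biset_pair.biset_biset_prod) (use that gr in \<open>simp add: biset_pair_def\<close>)
  have cong: "RB_class R G K (biset_prod H X Y) = RB_class R G K (biset_prod H X' Y')"
    if "biset G H X" "biset H K Y" "biset G H X'" "biset H K Y'"
      "biset_isomorphic G H X X'" "biset_isomorphic H K Y Y'"
    for X :: "('g, 'h, 'x) biset" and Y :: "('h, 'k, 'y) biset"
      and X' :: "('g, 'h, 'x') biset" and Y' :: "('h, 'k, 'y') biset"
    by (intro RB_class_iso[OF R] prod that biset_prod_cong[OF gr])
  have sum_left: "RB_class R G K (biset_prod H (biset_sum X X') Y)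
      = RB_class R G K (biset_prod H X Y) \<oplus>\<^bsub>RB R G K\<^esub> RB_class R G K (biset_prod H X' Y)"
    if "biset G H X" "biset G H X'" "biset H K Y"
    for X X' :: "('g, 'h, nat) biset" and Y :: "('h, 'k, nat) biset"
    unfolding RB_class_sum[OF R prod[OF that(1,3)] prod[OF that(2,3)], symmetric]
    by (intro RB_class_iso[OF R] prod biset_biset_sum that biset_prod_sum_left[OF gr])
  have sum_right: "RB_class R G K (biset_prod H X (biset_sum Y Y'))
      = RB_class R G K (biset_prod H X Y) \<oplus>\<^bsub>RB R G K\<^esub> RB_class R G K (biset_prod H X Y')"
    if "biset G H X" "biset H K Y" "biset H K Y'"
    for X :: "('g, 'h, nat) biset" and Y Y' :: "('h, 'k, nat) biset"
    unfolding RB_class_sum[OF R prod[OF that(1,2)] prod[OF that(1,3)], symmetric]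
    by (intro RB_class_iso[OF R] prod biset_biset_sum that biset_prod_sum_right[OF gr])
  have "\<exists>f. lin_map R (RB R G H) (RB R G K) f \<and>
      (\<forall>X :: ('g, 'h, nat) biset. biset G H X \<longrightarrow> f (RB_class R G H X) = RB_class R G K (biset_prod H X Y))"
    if Y: "biset H K Y" for Y :: "('h, 'k, nat) biset"
  proof (rule RB_lift[OF R mod, where F = "\<lambda>X. RB_class R G K (biset_prod H X Y)"])
    fix X X' Z :: "('g, 'h, nat) biset"
    assume X: "biset G H X"
    then show "RB_class R G K (biset_prod H X Y) \<in> carrier (RB R G K)"
      by (intro RB_class_closed[OF R] prod Y)
    assume X': "biset G H X'"
    show "RB_class R G K (biset_prod H X Y) = RB_class R G K (biset_prod H X' Y)"
      if "biset_isomorphic G H X X'"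
      by (intro cong that biset_isomorphic_refl X X' Y)
    assume Z: "biset G H Z" "biset_isomorphic G H Z (biset_sum X X')"
    show "RB_class R G K (biset_prod H Z Y)
        = RB_class R G K (biset_prod H X Y) \<oplus>\<^bsub>RB R G K\<^esub> RB_class R G K (biset_prod H X' Y)"
      unfolding sum_left[OF X X' Y, symmetric]
      by (intro cong Z biset_isomorphic_refl Y biset_biset_sum X X')
  qed blast
  then obtain f where f: "\<And>Y :: ('h, 'k, nat) biset. biset H K Y \<Longrightarrow> lin_map R (RB R G H) (RB R G K) (f Y)"
    and f_class: "\<And>(Y :: ('h, 'k, nat) biset) (X :: ('g, 'h, nat) biset). \<lbrakk>biset H K Y; biset G H X\<rbrakk>
        \<Longrightarrow> f Y (RB_class R G H X) = RB_class R G K (biset_prod H X Y)"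
    by metis
  have "\<exists>g. lin_map R (RB R H K) (RB R G K) g \<and>
      (\<forall>Y :: ('h, 'k, nat) biset. biset H K Y \<longrightarrow> g (RB_class R H K Y) = f Y a)"
    if a: "a \<in> carrier (RB R G H)" for a
  proof (rule RB_lift[OF R mod, where F = "\<lambda>Y. f Y a"])
    fix Y Y' Z :: "('h, 'k, nat) biset"
    assume Y: "biset H K Y"
    then show "f Y a \<in> carrier (RB R G K)" using lin_mapD(1)[OF f a] by blast
    assume Y': "biset H K Y'"
    show "f Y a = f Y' a" if iso: "biset_isomorphic H K Y Y'"
    proof (rule RB_lin_map_eqI[OF R mod f[OF Y] f[OF Y'] _ a])
      fix X :: "('g, 'h, nat) biset" assume X: "biset G H X"
      show "f Y (RB_class R G H X) = f Y' (RB_class R G H X)"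
        unfolding f_class[OF Y X] f_class[OF Y' X]
        by (intro cong iso biset_isomorphic_refl X Y Y')
    qed
    assume Z: "biset H K Z" "biset_isomorphic H K Z (biset_sum Y Y')"
    show "f Z a = f Y a \<oplus>\<^bsub>RB R G K\<^esub> f Y' a"
    proof (rule RB_lin_map_eqI[OF R mod f[OF Z(1)] lin_map_add[OF mod f[OF Y] f[OF Y']] _ a])
      fix X :: "('g, 'h, nat) biset" assume X: "biset G H X"
      show "f Z (RB_class R G H X) = f Y (RB_class R G H X) \<oplus>\<^bsub>RB R G K\<^esub> f Y' (RB_class R G H X)"
        unfolding f_class[OF Y X] f_class[OF Y' X] f_class[OF Z(1) X] sum_right[OF X Y Y', symmetric]
        by (intro cong Z biset_isomorphic_refl X biset_biset_sum Y Y')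
    qed
  qed blast
  then obtain g where g: "\<And>a. a \<in> carrier (RB R G H) \<Longrightarrow> lin_map R (RB R H K) (RB R G K) (g a)"
    and g_class: "\<And>a (Y :: ('h, 'k, nat) biset). \<lbrakk>a \<in> carrier (RB R G H); biset H K Y\<rbrakk>
        \<Longrightarrow> g a (RB_class R H K Y) = f Y a"
    by metis
  interpret GH: module R "RB R G H" by (rule mod)
  interpret HK: module R "RB R H K" by (rule mod)
  let ?D = "carrier (RB R G H) \<times> carrier (RB R H K)"
  let ?spec = "\<lambda>f. f \<in> extensional ?D
     \<and> bilin_map R (RB R G H) (RB R H K) (RB R G K) f
     \<and> (\<forall>(X :: ('g, 'h, nat) biset) (Y :: ('h, 'k, nat) biset).
          biset G H X \<longrightarrow> biset H K Y \<longrightarrow>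
          f (RB_class R G H X, RB_class R H K Y) = RB_class R G K (biset_prod H X Y))"
  define F where "F = (\<lambda>(a, b)\<in>?D. g a b)"
  have F: "F (a, b) = g a b" if "a \<in> carrier (RB R G H)" "b \<in> carrier (RB R H K)" for a b
    using that by (simp add: F_def)
  have "bilin_map R (RB R G H) (RB R H K) (RB R G K) F"
    unfolding bilin_map_def
  proof (intro conjI ballI)
    fix b assume b: "b \<in> carrier (RB R H K)"
    show "lin_map R (RB R G H) (RB R G K) (\<lambda>a. F (a, b))"
    proof (rule lin_mapI)
      fix a assume a: "a \<in> carrier (RB R G H)"
      then show "F (a, b) \<in> carrier (RB R G K)" using b lin_mapD(1)[OF g] by (simp add: F)
      show "F (r \<odot>\<^bsub>RB R G H\<^esub> a, b) = r \<odot>\<^bsub>RB R G K\<^esub> F (a, b)" if r: "r \<in> carrier R" for r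
      proof -
        have ra: "r \<odot>\<^bsub>RB R G H\<^esub> a \<in> carrier (RB R G H)" using a r by simp
        have "g (r \<odot>\<^bsub>RB R G H\<^esub> a) b = r \<odot>\<^bsub>RB R G K\<^esub> g a b"
          by (rule RB_lin_map_eqI[OF R mod g[OF ra] lin_map_smult[OF mod g[OF a] r] _ b])
            (simp add: g_class[OF ra] g_class[OF a] lin_mapD(3)[OF f r a])
        then show ?thesis using a b ra by (simp add: F)
      qed
      fix a' assume a': "a' \<in> carrier (RB R G H)"
      have aa: "a \<oplus>\<^bsub>RB R G H\<^esub> a' \<in> carrier (RB R G H)" using a a' by simp
      have "g (a \<oplus>\<^bsub>RB R G H\<^esub> a') b = g a b \<oplus>\<^bsub>RB R G K\<^esub> g a' b"
        by (rule RB_lin_map_eqI[OF R mod g[OF aa] lin_map_add[OF mod g[OF a] g[OF a']] _ b])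
          (simp add: g_class[OF aa] g_class[OF a] g_class[OF a'] lin_mapD(2)[OF f a a'])
      then show "F (a \<oplus>\<^bsub>RB R G H\<^esub> a', b) = F (a, b) \<oplus>\<^bsub>RB R G K\<^esub> F (a', b)"
        using a a' b aa by (simp add: F)
    qed
  next
    fix a assume a: "a \<in> carrier (RB R G H)"
    show "lin_map R (RB R H K) (RB R G K) (\<lambda>b. F (a, b))"
      by (rule lin_mapI) (simp_all add: F a lin_mapD[OF g[OF a]])
  qed
  moreover have F_class: "F (RB_class R G H X, RB_class R H K Y) = RB_class R G K (biset_prod H X Y)"
    if "biset G H X" "biset H K Y" for X :: "('g, 'h, nat) biset" and Y :: "('h, 'k, nat) biset"
    using that RB_class_closed[OF R that(1)] RB_class_closed[OF R that(2)] by (simp add: F g_class f_class)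
  ultimately have F_spec: "?spec F"
    by (simp add: F_def)
  have "F' = F" if "?spec F'" for F'
  proof (rule extensionalityI[of _ ?D])
    fix p assume "p \<in> ?D"
    then obtain a b where p: "p = (a, b)" "a \<in> carrier (RB R G H)" "b \<in> carrier (RB R H K)" by blast
    show "F' p = F p"
      unfolding p(1)
      by (rule RB_bilin_map_eqI[OF R mod _ _ _ p(2,3)]) (use that F_spec in auto)
  qed (use that F_spec in auto)
  with F_spec have "?spec (THE f. ?spec f)" by (rule theI)
  then show "bilin_map R (RB R G H) (RB R H K) (RB R G K) (\<lambda>(a, b). biset_comp R G H K a b)"
    and "\<And>(X :: ('g, 'h, nat) biset) (Y :: ('h, 'k, nat) biset). \<lbrakk>biset G H X; biset H K Y\<rbrakk>
      \<Longrightarrow> biset_comp R G H K (RB_class R G H X) (RB_class R H K Y) = RB_class R G K (biset_prod H X Y)"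
    unfolding biset_comp_def by auto
qed

section \<open>Free modules on subgroups\<close>

lemma module_free_module:
  fixes R :: "('r, 'n) ring_scheme" (structure)
  assumes "cring R"
  shows "module R (free_module R S)"
proof -
  interpret cring R by fact
  have mem: "u s \<in> carrier R" if "u \<in> S \<rightarrow>\<^sub>E carrier R" "s \<in> S" for u s
    using that by auto
  have eta: "(\<lambda>s\<in>S. f s) = u"
    if "u \<in> S \<rightarrow>\<^sub>E carrier R" "\<And>s. s \<in> S \<Longrightarrow> f s = u s" for u f
    using PiE_restrict[OF that(1)] restrict_ext[of S f u] that(2) by simp
  have fin_add: "finite {s \<in> S. u s \<oplus> v s \<noteq> \<zero>}"
    if "u \<in> S \<rightarrow>\<^sub>E carrier R" "v \<in> S \<rightarrow>\<^sub>E carrier R" "finite {s \<in> S. u s \<noteq> \<zero>}" "finite {s \<in> S. v s \<noteq> \<zero>}" for u v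
    by (rule finite_subset[OF _ finite_UnI[OF that(3,4)]]) auto
  have fin_smult: "finite {s \<in> S. r \<otimes> u s \<noteq> \<zero>}"
    if "r \<in> carrier R" "finite {s \<in> S. u s \<noteq> \<zero>}" for r u
    by (rule finite_subset[OF _ that(2)]) (use that(1) in auto)
  have fin_neg: "finite {s \<in> S. \<ominus> u s \<noteq> \<zero>}"
    if "finite {s \<in> S. u s \<noteq> \<zero>}" for u
    by (rule finite_subset[OF _ that]) auto
  show ?thesis
  proof (rule moduleI)
    show "abelian_group (free_module R S)"
    proof (rule abelian_groupI)
      fix u v w
      assume u: "u \<in> carrier (free_module R S)"
      then show "\<exists>v\<in>carrier (free_module R S). v \<oplus>\<^bsub>free_module R S\<^esub> u = \<zero>\<^bsub>free_module R S\<^esub>"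
        by (intro bexI[of _ "\<lambda>s\<in>S. \<ominus> u s"])
          (auto simp: free_module_def fin_neg mem cong: conj_cong intro!: restrict_ext l_neg)
      show "\<zero>\<^bsub>free_module R S\<^esub> \<oplus>\<^bsub>free_module R S\<^esub> u = u"
        using u by (auto simp: free_module_def mem intro!: eta)
      assume v: "v \<in> carrier (free_module R S)"
      show "u \<oplus>\<^bsub>free_module R S\<^esub> v \<in> carrier (free_module R S)"
        using u v by (auto simp: free_module_def fin_add mem cong: conj_cong)
      show "u \<oplus>\<^bsub>free_module R S\<^esub> v = v \<oplus>\<^bsub>free_module R S\<^esub> u"
        using u v by (auto simp: free_module_def mem intro!: restrict_ext a_comm)
      assume w: "w \<in> carrier (free_module R S)"
      show "u \<oplus>\<^bsub>free_module R S\<^esub> v \<oplus>\<^bsub>free_module R S\<^esub> w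
          = u \<oplus>\<^bsub>free_module R S\<^esub> (v \<oplus>\<^bsub>free_module R S\<^esub> w)"
        using u v w by (auto simp: free_module_def mem intro!: restrict_ext a_assoc)
    qed (auto simp: free_module_def cong: conj_cong)
  next
    fix r u assume r: "r \<in> carrier R" and u: "u \<in> carrier (free_module R S)"
    show "r \<odot>\<^bsub>free_module R S\<^esub> u \<in> carrier (free_module R S)"
      using r u by (auto simp: free_module_def fin_smult mem cong: conj_cong)
    show "r \<odot>\<^bsub>free_module R S\<^esub> (u \<oplus>\<^bsub>free_module R S\<^esub> v)
        = r \<odot>\<^bsub>free_module R S\<^esub> u \<oplus>\<^bsub>free_module R S\<^esub> r \<odot>\<^bsub>free_module R S\<^esub> v"
      if "v \<in> carrier (free_module R S)" for v
      using r u that by (auto simp: free_module_def mem intro!: restrict_ext r_distr)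
    fix t assume t: "t \<in> carrier R"
    show "(r \<oplus> t) \<odot>\<^bsub>free_module R S\<^esub> u
        = r \<odot>\<^bsub>free_module R S\<^esub> u \<oplus>\<^bsub>free_module R S\<^esub> t \<odot>\<^bsub>free_module R S\<^esub> u"
      using r t u by (auto simp: free_module_def mem intro!: restrict_ext l_distr)
    show "(r \<otimes> t) \<odot>\<^bsub>free_module R S\<^esub> u = r \<odot>\<^bsub>free_module R S\<^esub> (t \<odot>\<^bsub>free_module R S\<^esub> u)"
      using r t u by (auto simp: free_module_def mem intro!: restrict_ext m_assoc)
  next
    show "\<one> \<odot>\<^bsub>free_module R S\<^esub> u = u" if "u \<in> carrier (free_module R S)" for u
      using that by (auto simp: free_module_def mem intro!: eta)
  qed (rule assms)
qed

lemma module_RS: "cring R \<Longrightarrow> module R (RS R X)"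
  unfolding RS_def by (rule module_free_module)

lemma RS_basis_closed: "cring R \<Longrightarrow> RS_basis R X L \<in> carrier (RS R X)"
proof -
  assume "cring R"
  then interpret cring R .
  show ?thesis
    by (auto simp: RS_basis_def RS_def free_basis_def free_module_def
        intro: finite_subset[of _ "{L}"])
qed

lemma finite_subgroups_of: "finite (carrier X) \<Longrightarrow> finite (subgroups_of X)"
  by (rule finite_subset[of _ "Pow (carrier X)"]) (auto simp: subgroups_of_def dest: subgroup.subset)

section \<open>Stabilizers and orbits\<close>

text \<open>Moving \<open>h\<close> to the other side turns \<open>g x h\<inverse> = x\<close> into \<open>g x = x h\<close>, the form in which stabilizers are
  used from here on.\<close>

lemma mem_biset_stab:
  assumes "group H" "biset G H X" "x \<in> bset X"
  shows "(g, h) \<in> biset_stab G H X x \<longleftrightarrow> g \<in> carrier G \<and> h \<in> carrier H \<and> lact X g x = ract X x h"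
proof -
  interpret H: group H by fact
  interpret X: biset G H X by fact
  have "ract X (lact X g x) (inv\<^bsub>H\<^esub> h) = x \<longleftrightarrow> lact X g x = ract X x h"
    if gh: "g \<in> carrier G" "h \<in> carrier H"
  proof
    assume "ract X (lact X g x) (inv\<^bsub>H\<^esub> h) = x"
    then have "ract X (ract X (lact X g x) (inv\<^bsub>H\<^esub> h)) h = ract X x h" by simp
    then show "lact X g x = ract X x h"
      using gh assms(3) by (simp add: X.lact_closed X.ract_one flip: X.ract_mult)
  next
    assume "lact X g x = ract X x h"
    then show "ract X (lact X g x) (inv\<^bsub>H\<^esub> h) = x"
      using gh assms(3) by (simp add: X.ract_one flip: X.ract_mult)
  qed
  then show ?thesis
    by (auto simp: biset_stab_def stabilizer_def biset_action_def)
qed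

lemma biset_stab_subgroup:
  assumes "group G" "group H" "biset G H X" "x \<in> bset X"
  shows "biset_stab G H X x \<in> subgroups_of (G \<times>\<times> H)"
proof -
  interpret G: group G by fact
  interpret H: group H by fact
  interpret X: biset G H X by fact
  note mem = mem_biset_stab[OF assms(2-4)]
  have "subgroup (biset_stab G H X x) (G \<times>\<times> H)"
  proof (rule group.subgroupI[OF DirProd_group[OF assms(1,2)]])
    show "biset_stab G H X x \<subseteq> carrier (G \<times>\<times> H)" by (auto simp: mem)
    have "(\<one>\<^bsub>G\<^esub>, \<one>\<^bsub>H\<^esub>) \<in> biset_stab G H X x" using assms(4) by (simp add: mem X.lact_one X.ract_one)
    then show "biset_stab G H X x \<noteq> {}" by blast
  next
    fix p assume "p \<in> biset_stab G H X x"
    then obtain g h where p: "p = (g, h)" and gh: "g \<in> carrier G" "h \<in> carrier H"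
      and eq: "lact X g x = ract X x h"
      by (cases p) (auto simp: mem)
    have "ract X x (inv\<^bsub>H\<^esub> h) = lact X (inv\<^bsub>G\<^esub> g) (lact X g (ract X x (inv\<^bsub>H\<^esub> h)))"
      using gh assms(4) by (simp add: X.ract_closed X.lact_one flip: X.lact_mult)
    also have "lact X g (ract X x (inv\<^bsub>H\<^esub> h)) = ract X (ract X x h) (inv\<^bsub>H\<^esub> h)"
      using gh assms(4) by (simp add: eq flip: X.lact_ract)
    also have "\<dots> = x"
      using gh assms(4) by (simp add: X.ract_one flip: X.ract_mult)
    finally show "inv\<^bsub>G \<times>\<times> H\<^esub> p \<in> biset_stab G H X x"
      using gh by (simp add: p inv_DirProd[OF assms(1,2)] mem)
    fix q assume "q \<in> biset_stab G H X x"
    then obtain g' h' where q: "q = (g', h')" and gh': "g' \<in> carrier G" "h' \<in> carrier H"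
      and eq': "lact X g' x = ract X x h'"
      by (cases q) (auto simp: mem)
    have "lact X (g \<otimes>\<^bsub>G\<^esub> g') x = ract X x (h \<otimes>\<^bsub>H\<^esub> h')"
      using gh gh' assms(4) by (simp add: X.lact_mult X.ract_mult eq' eq flip: X.lact_ract)
    then show "p \<otimes>\<^bsub>G \<times>\<times> H\<^esub> q \<in> biset_stab G H X x"
      using gh gh' by (simp add: p q mem)
  qed
  then show ?thesis by (simp add: subgroups_of_def)
qed

context biset_pair
begin

text \<open>A pair \<open>(g, k)\<close> fixes the orbit of \<open>(x, y)\<close> iff \<open>(g x, y)\<close> and \<open>(x, y k)\<close> lie in the same
  orbit, iff \<open>g x = x h\<close> and \<open>h y = y k\<close> for some \<open>h\<close>; and this says that \<open>(g, h)\<close> fixes \<open>x\<close> and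
  \<open>(h, k)\<close> fixes \<open>y\<close>.\<close>

lemma biset_stab_biset_prod:
  assumes x: "x \<in> bset X" and y: "y \<in> bset Y"
  shows "biset_stab G K (biset_prod H X Y) (orb x y)
    = subgroup_star G H K (biset_stab G H X x) (biset_stab H K Y y)"
proof -
  have shift: "(\<exists>h\<in>carrier H. lact X g x = ract X x (inv h) \<and> y = lact Y h (ract Y y k)) \<longleftrightarrow>
      (\<exists>h\<in>carrier H. lact X g x = ract X x h \<and> lact Y h y = ract Y y k)"
    if k: "k \<in> carrier K" for g k
  proof safe
    fix h assume h: "h \<in> carrier H" "lact X g x = ract X x (inv h)" and eq: "y = lact Y h (ract Y y k)"
    have "lact Y (inv h) y = ract Y y k"
      using lact_inv_cancel(2)[OF h(1) Y.ract_closed[OF k y]] eq by simp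
    then show "\<exists>h\<in>carrier H. lact X g x = ract X x h \<and> lact Y h y = ract Y y k"
      using h by blast
  next
    fix h assume h: "h \<in> carrier H" "lact X g x = ract X x h" and eq: "lact Y h y = ract Y y k"
    have "y = lact Y (inv h) (ract Y y k)"
      using lact_inv_cancel(2)[OF h(1) y] eq by simp
    then show "\<exists>h\<in>carrier H. lact X g x = ract X x (inv h) \<and> y = lact Y h (ract Y y k)"
      using h by (intro bexI[of _ "inv h"]) auto
  qed
  have orb_iff: "orb (lact X g x) y = orb x (ract Y y k) \<longleftrightarrow>
      (\<exists>h\<in>carrier H. lact X g x = ract X x h \<and> lact Y h y = ract Y y k)"
    if "g \<in> carrier G" "k \<in> carrier K" for g k
    using orb_eq_iff[of x "ract Y y k" "lact X g x" y] that x y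
    by (simp add: X.lact_closed Y.ract_closed eq_commute[of "orb (lact X g x) y"] shift)
  have lhs: "(g, k) \<in> biset_stab G K (biset_prod H X Y) (orb x y) \<longleftrightarrow>
      g \<in> carrier G \<and> k \<in> carrier K \<and> orb (lact X g x) y = orb x (ract Y y k)" for g k
    using mem_biset_stab[OF K.is_group biset_biset_prod orb_closed[OF x y], of g k] x y
    by (metis lact_biset_prod ract_biset_prod)
  have rhs: "(g, k) \<in> subgroup_star G H K (biset_stab G H X x) (biset_stab H K Y y) \<longleftrightarrow>
      g \<in> carrier G \<and> k \<in> carrier K
        \<and> (\<exists>h\<in>carrier H. lact X g x = ract X x h \<and> lact Y h y = ract Y y k)" for g k
    by (auto simp: subgroup_star_def mem_biset_stab[OF H.is_group X.biset_axioms x]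
        mem_biset_stab[OF K.is_group Y.biset_axioms y])
  show ?thesis
  proof (rule Set.set_eqI)
    fix p
    show "p \<in> biset_stab G K (biset_prod H X Y) (orb x y)
        \<longleftrightarrow> p \<in> subgroup_star G H K (biset_stab G H X x) (biset_stab H K Y y)"
      by (cases p) (simp add: lhs rhs orb_iff cong: conj_cong)
  qed
qed

text \<open>The intersection that occurs in the weight \<open>kappa\<close> is \<open>{h. x h = x \<and> h y = y}\<close>, the stabilizer of
  \<open>(x, y)\<close> in \<open>H\<close>. So this is the orbit-stabilizer theorem: the fibres of \<open>act\<close>, which maps \<open>H\<close> onto
  the orbit, are the left cosets of the stabilizer \<open>S\<close>.\<close>

lemma card_orb_mult_card_stab:
  assumes x: "x \<in> bset X" and y: "y \<in> bset Y" and fin: "finite (carrier H)"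
  shows "card (orb x y) * card (k2 G H (biset_stab G H X x) \<inter> k1 H K (biset_stab H K Y y)) = order H"
proof -
  define act where "act h = (ract X x (inv h), lact Y h y)" for h
  define S where "S = {h \<in> carrier H. act h = (x, y)}"
  have "ract X x (inv h) = x \<longleftrightarrow> ract X x h = x" if "h \<in> carrier H" for h
    using ract_inv_cancel[OF that x] by metis
  then have S: "k2 G H (biset_stab G H X x) \<inter> k1 H K (biset_stab H K Y y) = S"
    using x y by (auto simp: S_def act_def k1_def k2_def mem_biset_stab[OF H.is_group X.biset_axioms x]
        mem_biset_stab[OF K.is_group Y.biset_axioms y] X.lact_one Y.ract_one)
  have act_mult: "act (h \<otimes> s) = (ract X (fst (act s)) (inv h), lact Y h (snd (act s)))"
    if "h \<in> carrier H" "s \<in> carrier H" for h s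
    using that x y by (simp add: act_def H.inv_mult_group X.ract_mult Y.lact_mult)
  have fibre: "card {h' \<in> carrier H. act h' = act h} = card S" if h: "h \<in> carrier H" for h
  proof -
    have "bij_betw (\<lambda>s. h \<otimes> s) S {h' \<in> carrier H. act h' = act h}"
    proof (rule bij_betw_byWitness[where f' = "\<lambda>h'. inv h \<otimes> h'"])
      show "(\<lambda>s. h \<otimes> s) ` S \<subseteq> {h' \<in> carrier H. act h' = act h}"
        using h by (auto simp: S_def act_mult) (simp_all add: act_def)
      have "act (inv h \<otimes> h') = (x, y)" if h': "h' \<in> carrier H" "act h' = act h" for h'
      proof -
        have "act (inv h \<otimes> h') = act (inv h \<otimes> h)"
          using h h' act_mult[of "inv h" h'] act_mult[of "inv h" h] by simp
        then show ?thesis using h x y by (simp add: act_def X.ract_one Y.lact_one)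
      qed
      then show "(\<lambda>h'. inv h \<otimes> h') ` {h' \<in> carrier H. act h' = act h} \<subseteq> S"
        using h by (auto simp: S_def)
    qed (use h in \<open>auto simp: S_def simp flip: H.m_assoc\<close>)
    then show ?thesis by (simp add: bij_betw_same_card)
  qed
  have "order H = (\<Sum>h\<in>carrier H. 1)" by (simp add: order_def)
  also have "\<dots> = (\<Sum>p\<in>act ` carrier H. \<Sum>h\<in>{h' \<in> carrier H. act h' = p}. 1)"
    by (rule sum.image_gen[OF fin])
  also have "\<dots> = (\<Sum>p\<in>act ` carrier H. card S)"
    by (intro sum.cong refl) (auto simp: fibre)
  also have "act ` carrier H = orb x y"
    by (auto simp: act_def prod_orbit_def)
  finally show ?thesis by (simp add: S)
qed

lemma disjoint_orbits: "pairwise disjnt (bset (biset_prod H X Y))"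
proof (rule pairwiseI)
  fix P Q assume "P \<in> bset (biset_prod H X Y)" "Q \<in> bset (biset_prod H X Y)" "P \<noteq> Q"
  moreover have "orb a b = P" if "(a, b) \<in> P" "P \<in> bset (biset_prod H X Y)" for a b P
    using that orb_memD unfolding bset_biset_prod by blast
  ultimately show "disjnt P Q"
    unfolding disjnt_def by (metis IntE equals0I surj_pair)
qed

lemma Union_orbits: "\<Union> (bset (biset_prod H X Y)) = bset X \<times> bset Y"
proof
  show "\<Union> (bset (biset_prod H X Y)) \<subseteq> bset X \<times> bset Y"
    unfolding bset_biset_prod using orb_subset by blast
  show "bset X \<times> bset Y \<subseteq> \<Union> (bset (biset_prod H X Y))"
    unfolding bset_biset_prod using orb_refl by blast
qed

end

section \<open>The stabilizer map\<close>

text \<open>The value of \<open>alpha\<close> on the class of \<open>X\<close>, for a biset over any type.\<close>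

definition stab_sum ::
  "('r, 'n) ring_scheme \<Rightarrow> ('g, 'm) monoid_scheme \<Rightarrow> ('h, 'p) monoid_scheme \<Rightarrow> ('g, 'h, 'x) biset
    \<Rightarrow> (('g \<times> 'h) set \<Rightarrow> 'r)" where
  "stab_sum R G H X = (\<Oplus>\<^bsub>RS R (G \<times>\<times> H)\<^esub>x\<in>bset X. RS_basis R (G \<times>\<times> H) (biset_stab G H X x))"

context
  fixes R :: "('r, 'n) ring_scheme" and G :: "('g, 'm) monoid_scheme" and H :: "('h, 'p) monoid_scheme"
  assumes R: "cring R" and grH: "group H"
begin

interpretation RS: module R "RS R (G \<times>\<times> H)" by (rule module_RS[OF R])

lemma stab_sum_closed: "stab_sum R G H X \<in> carrier (RS R (G \<times>\<times> H))"
  unfolding stab_sum_def by (rule RS.finsum_closed) (simp add: RS_basis_closed[OF R])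

text \<open>Stated for injections rather than isomorphisms, so as to cover the two inclusions into a disjoint
  sum as well.\<close>

lemma biset_stab_inj:
  assumes X: "biset G H X" and Y: "biset G H Y" and inj: "inj_on f (bset X)" and fY: "\<And>x. x \<in> bset X \<Longrightarrow> f x \<in> bset Y"
    and left: "\<And>g x. \<lbrakk>g \<in> carrier G; x \<in> bset X\<rbrakk> \<Longrightarrow> f (lact X g x) = lact Y g (f x)"
    and right: "\<And>h x. \<lbrakk>h \<in> carrier H; x \<in> bset X\<rbrakk> \<Longrightarrow> f (ract X x h) = ract Y (f x) h"
    and x: "x \<in> bset X"
  shows "biset_stab G H Y (f x) = biset_stab G H X x"
proof -
  have "(g, h) \<in> biset_stab G H Y (f x) \<longleftrightarrow> (g, h) \<in> biset_stab G H X x" for g h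
    using inj_on_eq_iff[OF inj biset.lact_closed[OF X _ x] biset.ract_closed[OF X _ x], of g h] x
    by (auto simp: mem_biset_stab[OF grH X x] mem_biset_stab[OF grH Y fY[OF x]] left[symmetric] right[symmetric])
  then show ?thesis by auto
qed

lemma stab_sum_iso:
  assumes X: "biset G H X" and Y: "biset G H Y" and iso: "biset_isomorphic G H X Y"
  shows "stab_sum R G H X = stab_sum R G H Y"
proof -
  obtain f where f: "bij_betw f (bset X) (bset Y)"
    "\<forall>x\<in>bset X. f x \<in> bset Y"
    "\<forall>g\<in>carrier G. \<forall>x\<in>bset X. f (lact X g x) = lact Y g (f x)"
    "\<forall>h\<in>carrier H. \<forall>x\<in>bset X. f (ract X x h) = ract Y (f x) h"
    using biset_isomorphicE[OF iso] by blast
  have inj: "inj_on f (bset X)" and img: "f ` bset X = bset Y" using f(1) by (auto simp: bij_betw_def)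
  have stab: "biset_stab G H Y (f x) = biset_stab G H X x" if "x \<in> bset X" for x
    by (rule biset_stab_inj[OF X Y inj _ _ _ that]) (use f in auto)
  have "stab_sum R G H Y = (\<Oplus>\<^bsub>RS R (G \<times>\<times> H)\<^esub>x\<in>bset X. RS_basis R (G \<times>\<times> H) (biset_stab G H Y (f x)))"
    unfolding stab_sum_def img[symmetric]
    by (rule RS.finsum_reindex) (simp_all add: RS_basis_closed[OF R] inj)
  also have "\<dots> = stab_sum R G H X"
    unfolding stab_sum_def
    by (rule RS.finsum_cong') (simp_all add: RS_basis_closed[OF R] stab)
  finally show ?thesis by simp
qed

lemma stab_sum_biset_sum:
  assumes X: "biset G H X" and Y: "biset G H Y"
  shows "stab_sum R G H (biset_sum X Y) = stab_sum R G H X \<oplus>\<^bsub>RS R (G \<times>\<times> H)\<^esub> stab_sum R G H Y"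
proof -
  let ?e = "\<lambda>z. RS_basis R (G \<times>\<times> H) (biset_stab G H (biset_sum X Y) z)"
  note S = biset_biset_sum[OF X Y]
  have l: "biset_stab G H (biset_sum X Y) (Inl x) = biset_stab G H X x" if "x \<in> bset X" for x
    by (rule biset_stab_inj[OF X S _ _ _ _ that]) (auto simp: biset_sum_def)
  have r: "biset_stab G H (biset_sum X Y) (Inr y) = biset_stab G H Y y" if "y \<in> bset Y" for y
    by (rule biset_stab_inj[OF Y S _ _ _ _ that]) (auto simp: biset_sum_def)
  have "stab_sum R G H (biset_sum X Y) = (\<Oplus>\<^bsub>RS R (G \<times>\<times> H)\<^esub>z\<in>Inl ` bset X \<union> Inr ` bset Y. ?e z)"
    by (simp add: stab_sum_def biset_sum_def Plus_def)
  also have "\<dots> = (\<Oplus>\<^bsub>RS R (G \<times>\<times> H)\<^esub>z\<in>Inl ` bset X. ?e z) \<oplus>\<^bsub>RS R (G \<times>\<times> H)\<^esub> (\<Oplus>\<^bsub>RS R (G \<times>\<times> H)\<^esub>z\<in>Inr ` bset Y. ?e z)"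
    by (rule RS.finsum_Un_disjoint)
      (use biset.finite_bset[OF X] biset.finite_bset[OF Y] in \<open>auto simp: RS_basis_closed[OF R]\<close>)
  also have "(\<Oplus>\<^bsub>RS R (G \<times>\<times> H)\<^esub>z\<in>Inl ` bset X. ?e z) = (\<Oplus>\<^bsub>RS R (G \<times>\<times> H)\<^esub>x\<in>bset X. ?e (Inl x))"
    by (rule RS.finsum_reindex) (simp_all add: RS_basis_closed[OF R])
  also have "\<dots> = stab_sum R G H X"
    unfolding stab_sum_def by (rule RS.finsum_cong') (simp_all add: RS_basis_closed[OF R] l)
  also have "(\<Oplus>\<^bsub>RS R (G \<times>\<times> H)\<^esub>z\<in>Inr ` bset Y. ?e z) = (\<Oplus>\<^bsub>RS R (G \<times>\<times> H)\<^esub>y\<in>bset Y. ?e (Inr y))"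
    by (rule RS.finsum_reindex) (simp_all add: RS_basis_closed[OF R])
  also have "\<dots> = stab_sum R G H Y"
    unfolding stab_sum_def by (rule RS.finsum_cong') (simp_all add: RS_basis_closed[OF R] r)
  finally show ?thesis .
qed

lemma alpha_spec:
  shows "lin_map R (RB R G H) (RS R (G \<times>\<times> H)) (alpha R G H)"
    and "\<And>X :: ('g, 'h, nat) biset. biset G H X \<Longrightarrow> alpha R G H (RB_class R G H X) = stab_sum R G H X"
proof -
  interpret RB: module R "RB R G H" by (rule module_RB[OF R])
  let ?spec = "\<lambda>f. f \<in> extensional (carrier (RB R G H))
     \<and> lin_map R (RB R G H) (RS R (G \<times>\<times> H)) f
     \<and> (\<forall>X :: ('g, 'h, nat) biset. biset G H X \<longrightarrow> f (RB_class R G H X) =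
            (\<Oplus>\<^bsub>RS R (G \<times>\<times> H)\<^esub>x\<in>bset X. RS_basis R (G \<times>\<times> H) (biset_stab G H X x)))"
  obtain f where f: "lin_map R (RB R G H) (RS R (G \<times>\<times> H)) f"
    and f_class: "\<And>X :: ('g, 'h, nat) biset. biset G H X \<Longrightarrow> f (RB_class R G H X) = stab_sum R G H X"
  proof (rule RB_lift[OF R RS.module_axioms, where F = "stab_sum R G H" and G = G and H = H])
    fix X Y Z :: "('g, 'h, nat) biset"
    assume X: "biset G H X" and Y: "biset G H Y"
    show "stab_sum R G H X = stab_sum R G H Y" if "biset_isomorphic G H X Y"
      by (rule stab_sum_iso[OF X Y that])
    assume Z: "biset G H Z" "biset_isomorphic G H Z (biset_sum X Y)"
    show "stab_sum R G H Z = stab_sum R G H X \<oplus>\<^bsub>RS R (G \<times>\<times> H)\<^esub> stab_sum R G H Y"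
      using stab_sum_iso[OF Z(1) biset_biset_sum[OF X Y] Z(2)] stab_sum_biset_sum[OF X Y] by simp
  qed (rule stab_sum_closed, blast)
  define F where "F = restrict f (carrier (RB R G H))"
  have "lin_map R (RB R G H) (RS R (G \<times>\<times> H)) F"
    by (rule lin_mapI) (simp_all add: F_def lin_mapD[OF f])
  moreover have "F (RB_class R G H X) = stab_sum R G H X" if "biset G H X" for X :: "('g, 'h, nat) biset"
    using RB_class_closed[OF R that] f_class[OF that] by (simp add: F_def)
  ultimately have F_spec: "?spec F"
    by (simp add: F_def stab_sum_def)
  have "F' = F" if "?spec F'" for F'
  proof (rule extensionalityI[of _ "carrier (RB R G H)"])
    fix a assume a: "a \<in> carrier (RB R G H)"
    show "F' a = F a"
      by (rule RB_lin_map_eqI[OF R RS.module_axioms _ _ _ a]) (use that F_spec in auto)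
  qed (use that F_spec in auto)
  with F_spec have "?spec (THE f. ?spec f)" by (rule theI)
  then show "lin_map R (RB R G H) (RS R (G \<times>\<times> H)) (alpha R G H)"
    and "\<And>X :: ('g, 'h, nat) biset. biset G H X \<Longrightarrow> alpha R G H (RB_class R G H X) = stab_sum R G H X"
    unfolding alpha_def stab_sum_def by auto
qed

text \<open>The defining property of \<open>alpha\<close> concerns bisets on natural numbers. It is needed for a product of
  such bisets, whose elements are sets of pairs.\<close>

lemma alpha_RB_class:
  fixes X :: "('g, 'h, 'x) biset"
  assumes X: "biset G H X"
  shows "alpha R G H (RB_class R G H X) = stab_sum R G H X"
proof -
  obtain Z :: "('g, 'h, nat) biset" where Z: "biset G H Z" "biset_isomorphic G H X Z"
    by (rule biset_nat_copy[OF X])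
  show ?thesis
    unfolding RB_class_iso[OF R X Z] stab_sum_iso[OF X Z] by (rule alpha_spec(2)[OF Z(1)])
qed

end

section \<open>The weighted star product\<close>

lemma (in abelian_monoid) finsum_Times:
  assumes "finite A" "finite B" "\<And>a b. \<lbrakk>a \<in> A; b \<in> B\<rbrakk> \<Longrightarrow> f a b \<in> carrier G"
  shows "(\<Oplus>a\<in>A. \<Oplus>b\<in>B. f a b) = (\<Oplus>p\<in>A \<times> B. case p of (a, b) \<Rightarrow> f a b)"
proof -
  have "(\<Oplus>p\<in>A \<times> B. case p of (a, b) \<Rightarrow> f a b) = (\<Oplus>p\<in>(\<Union>a\<in>A. Pair a ` B). case p of (a, b) \<Rightarrow> f a b)"
    by (rule arg_cong[of _ _ "finsum G _"]) auto
  also have "\<dots> = (\<Oplus>a\<in>A. \<Oplus>p\<in>Pair a ` B. case p of (a, b) \<Rightarrow> f a b)"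
    by (rule add.finprod_UN_disjoint) (use assms in \<open>auto simp: pairwise_def disjnt_def\<close>)
  also have "\<dots> = (\<Oplus>a\<in>A. \<Oplus>b\<in>B. f a b)"
  proof (rule finsum_cong')
    fix a assume a: "a \<in> A"
    show "(\<Oplus>p\<in>Pair a ` B. case p of (a, b) \<Rightarrow> f a b) = (\<Oplus>b\<in>B. f a b)"
      by (subst finsum_reindex) (use a assms(3) in \<open>auto simp: inj_on_def\<close>)
  qed (use assms in \<open>auto intro: finsum_closed\<close>)
  finally show ?thesis by simp
qed

lemma (in module) finsum_const_smult:
  assumes "finite A" "c \<in> carrier R" "e \<in> carrier M"
  shows "(\<Oplus>\<^bsub>M\<^esub>i\<in>A. c \<odot>\<^bsub>M\<^esub> e) = ([card A] \<cdot> c) \<odot>\<^bsub>M\<^esub> e"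
  using assms
proof (induction A rule: finite_induct)
  case (insert a A)
  then show ?case
    by (simp add: smult_l_distr R.add.nat_pow_closed M.add.m_comm R.add.nat_pow_Suc)
qed simp

context
  fixes R :: "('r, 'n) ring_scheme" and G :: "('g, 'm) monoid_scheme"
    and H :: "('h, 'p) monoid_scheme" and K :: "('k, 'q) monoid_scheme"
  assumes R: "cring R" and unit: "[order H] \<cdot>\<^bsub>R\<^esub> \<one>\<^bsub>R\<^esub> \<in> Units R"
    and fin: "finite (carrier G)" "finite (carrier H)" "finite (carrier K)"
begin

interpretation R: cring R by (rule R)
interpretation GK: module R "RS R (G \<times>\<times> K)" by (rule module_RS[OF R])

lemma kappa_closed: "kappa R G H K L M \<in> carrier R"
  unfolding kappa_def using unit by simp

lemma kappa_term_closed: "kappa R G H K L M \<odot>\<^bsub>RS R (G \<times>\<times> K)\<^esub> RS_basis R (G \<times>\<times> K) N \<in> carrier (RS R (G \<times>\<times> K))"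
  by (simp add: kappa_closed RS_basis_closed[OF R])

lemma RS_mem: "\<lbrakk>u \<in> carrier (RS R X); L \<in> subgroups_of X\<rbrakk> \<Longrightarrow> u L \<in> carrier R"
  by (auto simp: RS_def free_module_def)

lemma fin_subgroups: "finite (subgroups_of (G \<times>\<times> H))" "finite (subgroups_of (H \<times>\<times> K))"
  using fin by (auto intro!: finite_subgroups_of)

text \<open>For fixed \<open>L\<close> and \<open>M\<close> the summand is a fixed vector, called \<open>c L M\<close> in the proof, with coefficient
  \<open>u L\<close> times \<open>v M\<close>, which is bilinear in \<open>u\<close> and \<open>v\<close>.\<close>

lemma kappa_star_bilinear:
  "bilin_map R (RS R (G \<times>\<times> H)) (RS R (H \<times>\<times> K)) (RS R (G \<times>\<times> K)) (\<lambda>(u, v). kappa_star R G H K u v)"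
proof -
  interpret GH: module R "RS R (G \<times>\<times> H)" by (rule module_RS[OF R])
  interpret HK: module R "RS R (H \<times>\<times> K)" by (rule module_RS[OF R])
  let ?M = "RS R (G \<times>\<times> K)"
  let ?A = "subgroups_of (G \<times>\<times> H)" and ?B = "subgroups_of (H \<times>\<times> K)"
  define c where "c L M = kappa R G H K L M \<odot>\<^bsub>?M\<^esub> RS_basis R (G \<times>\<times> K) (subgroup_star G H K L M)" for L M
  have c: "c L M \<in> carrier ?M" for L M unfolding c_def by (rule kappa_term_closed)
  have star: "kappa_star R G H K u v = (\<Oplus>\<^bsub>?M\<^esub>p\<in>?A \<times> ?B. case p of (L, M) \<Rightarrow> (u L \<otimes>\<^bsub>R\<^esub> v M) \<odot>\<^bsub>?M\<^esub> c L M)"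
    if "u \<in> carrier (RS R (G \<times>\<times> H))" "v \<in> carrier (RS R (H \<times>\<times> K))" for u v
    unfolding kappa_star_def c_def[symmetric]
    by (rule GK.finsum_Times) (simp_all add: fin_subgroups RS_mem[OF that(1)] RS_mem[OF that(2)] c)
  have add: "(\<Oplus>\<^bsub>?M\<^esub>p\<in>?A \<times> ?B. f p) \<oplus>\<^bsub>?M\<^esub> (\<Oplus>\<^bsub>?M\<^esub>p\<in>?A \<times> ?B. f' p) = (\<Oplus>\<^bsub>?M\<^esub>p\<in>?A \<times> ?B. g p)"
    if "\<And>p. p \<in> ?A \<times> ?B \<Longrightarrow> f p \<in> carrier ?M" "\<And>p. p \<in> ?A \<times> ?B \<Longrightarrow> f' p \<in> carrier ?M"
      "\<And>p. p \<in> ?A \<times> ?B \<Longrightarrow> g p = f p \<oplus>\<^bsub>?M\<^esub> f' p" for f f' g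
  proof -
    have "(\<Oplus>\<^bsub>?M\<^esub>p\<in>?A \<times> ?B. g p) = (\<Oplus>\<^bsub>?M\<^esub>p\<in>?A \<times> ?B. f p \<oplus>\<^bsub>?M\<^esub> f' p)"
      by (rule GK.finsum_cong') (simp_all add: that Pi_I del: mem_Sigma_iff)
    also have "\<dots> = (\<Oplus>\<^bsub>?M\<^esub>p\<in>?A \<times> ?B. f p) \<oplus>\<^bsub>?M\<^esub> (\<Oplus>\<^bsub>?M\<^esub>p\<in>?A \<times> ?B. f' p)"
      by (rule GK.finsum_addf) (simp_all add: that Pi_I del: mem_Sigma_iff)
    finally show ?thesis by simp
  qed
  have smult: "r \<odot>\<^bsub>?M\<^esub> (\<Oplus>\<^bsub>?M\<^esub>p\<in>?A \<times> ?B. f p) = (\<Oplus>\<^bsub>?M\<^esub>p\<in>?A \<times> ?B. g p)"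
    if "r \<in> carrier R" "\<And>p. p \<in> ?A \<times> ?B \<Longrightarrow> f p \<in> carrier ?M"
      "\<And>p. p \<in> ?A \<times> ?B \<Longrightarrow> g p = r \<odot>\<^bsub>?M\<^esub> f p" for r f g
  proof -
    have "(\<Oplus>\<^bsub>?M\<^esub>p\<in>?A \<times> ?B. g p) = (\<Oplus>\<^bsub>?M\<^esub>p\<in>?A \<times> ?B. r \<odot>\<^bsub>?M\<^esub> f p)"
      by (rule GK.finsum_cong') (simp_all add: that Pi_I del: mem_Sigma_iff)
    also have "\<dots> = r \<odot>\<^bsub>?M\<^esub> (\<Oplus>\<^bsub>?M\<^esub>p\<in>?A \<times> ?B. f p)"
      using fin_subgroups by (intro GK.finsum_smult_ldistr[symmetric] that) (simp_all add: that Pi_I del: mem_Sigma_iff)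
    finally show ?thesis by simp
  qed
  have closed: "kappa_star R G H K u v \<in> carrier ?M"
    if "u \<in> carrier (RS R (G \<times>\<times> H))" "v \<in> carrier (RS R (H \<times>\<times> K))" for u v
    unfolding star[OF that] by (rule GK.finsum_closed) (auto simp: RS_mem[OF that(1)] RS_mem[OF that(2)] c)
  show ?thesis
    unfolding bilin_map_def split
  proof (intro conjI ballI; rule lin_mapI)
    fix u v assume u: "u \<in> carrier (RS R (G \<times>\<times> H))" and v: "v \<in> carrier (RS R (H \<times>\<times> K))"
    note uL = RS_mem[OF u] and vM = RS_mem[OF v]
    show "kappa_star R G H K u v \<in> carrier ?M" by (rule closed[OF u v])
    then show "kappa_star R G H K u v \<in> carrier ?M" .
    show "kappa_star R G H K (u \<oplus>\<^bsub>RS R (G \<times>\<times> H)\<^esub> w) v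
        = kappa_star R G H K u v \<oplus>\<^bsub>?M\<^esub> kappa_star R G H K w v"
      if w: "w \<in> carrier (RS R (G \<times>\<times> H))" for w
    proof -
      have "(u \<oplus>\<^bsub>RS R (G \<times>\<times> H)\<^esub> w) L = u L \<oplus>\<^bsub>R\<^esub> w L" if "L \<in> ?A" for L
        using that by (simp add: RS_def free_module_def)
      then show ?thesis
        unfolding star[OF u v] star[OF w v] star[OF GH.add.m_closed[OF u w] v]
        by (intro add[symmetric]) (auto simp: uL vM RS_mem[OF w] c R.l_distr GK.smult_l_distr)
    qed
    show "kappa_star R G H K u (v \<oplus>\<^bsub>RS R (H \<times>\<times> K)\<^esub> w)
        = kappa_star R G H K u v \<oplus>\<^bsub>?M\<^esub> kappa_star R G H K u w"
      if w: "w \<in> carrier (RS R (H \<times>\<times> K))" for w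
    proof -
      have "(v \<oplus>\<^bsub>RS R (H \<times>\<times> K)\<^esub> w) L = v L \<oplus>\<^bsub>R\<^esub> w L" if "L \<in> ?B" for L
        using that by (simp add: RS_def free_module_def)
      then show ?thesis
        unfolding star[OF u v] star[OF u w] star[OF u HK.add.m_closed[OF v w]]
        by (intro add[symmetric]) (auto simp: uL vM RS_mem[OF w] c R.r_distr GK.smult_l_distr)
    qed
    fix r assume r: "r \<in> carrier R"
    have "(r \<odot>\<^bsub>RS R (G \<times>\<times> H)\<^esub> u) L = r \<otimes>\<^bsub>R\<^esub> u L" if "L \<in> ?A" for L
      using that by (simp add: RS_def free_module_def)
    then show "kappa_star R G H K (r \<odot>\<^bsub>RS R (G \<times>\<times> H)\<^esub> u) v = r \<odot>\<^bsub>?M\<^esub> kappa_star R G H K u v"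
      unfolding star[OF u v] star[OF GH.smult_closed[OF r u] v]
      by (intro smult[symmetric] r) (auto simp: uL vM r c R.m_assoc GK.smult_assoc1)
    have "(r \<odot>\<^bsub>RS R (H \<times>\<times> K)\<^esub> v) L = r \<otimes>\<^bsub>R\<^esub> v L" if "L \<in> ?B" for L
      using that by (simp add: RS_def free_module_def)
    then show "kappa_star R G H K u (r \<odot>\<^bsub>RS R (H \<times>\<times> K)\<^esub> v) = r \<odot>\<^bsub>?M\<^esub> kappa_star R G H K u v"
      unfolding star[OF u v] star[OF u HK.smult_closed[OF r v]]
      by (intro smult[symmetric] r) (auto simp: uL vM r c R.m_lcomm GK.smult_assoc1)
  qed
qed

lemma kappa_star_basis:
  assumes L: "L \<in> subgroups_of (G \<times>\<times> H)" and M: "M \<in> subgroups_of (H \<times>\<times> K)"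
  shows "kappa_star R G H K (RS_basis R (G \<times>\<times> H) L) (RS_basis R (H \<times>\<times> K) M)
    = kappa R G H K L M \<odot>\<^bsub>RS R (G \<times>\<times> K)\<^esub> RS_basis R (G \<times>\<times> K) (subgroup_star G H K L M)"
proof -
  let ?M = "RS R (G \<times>\<times> K)"
  let ?A = "subgroups_of (G \<times>\<times> H)" and ?B = "subgroups_of (H \<times>\<times> K)"
  define c where "c L M = kappa R G H K L M \<odot>\<^bsub>?M\<^esub> RS_basis R (G \<times>\<times> K) (subgroup_star G H K L M)" for L M
  have c: "c L M \<in> carrier ?M" for L M unfolding c_def by (rule kappa_term_closed)
  have "kappa_star R G H K (RS_basis R (G \<times>\<times> H) L) (RS_basis R (H \<times>\<times> K) M)
      = (\<Oplus>\<^bsub>?M\<^esub>L'\<in>?A. if L' = L then (\<Oplus>\<^bsub>?M\<^esub>M'\<in>?B. if M' = M then c L' M' else \<zero>\<^bsub>?M\<^esub>) else \<zero>\<^bsub>?M\<^esub>)"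
    unfolding kappa_star_def c_def[symmetric]
  proof (rule GK.finsum_cong')
    fix L' assume L': "L' \<in> ?A"
    have "(\<Oplus>\<^bsub>?M\<^esub>M'\<in>?B. (RS_basis R (G \<times>\<times> H) L L' \<otimes>\<^bsub>R\<^esub> RS_basis R (H \<times>\<times> K) M M') \<odot>\<^bsub>?M\<^esub> c L' M')
        = (\<Oplus>\<^bsub>?M\<^esub>M'\<in>?B. if L' = L then (if M' = M then c L' M' else \<zero>\<^bsub>?M\<^esub>) else \<zero>\<^bsub>?M\<^esub>)"
      by (rule GK.finsum_cong') (use L' c in \<open>auto simp: RS_basis_def free_basis_def\<close>)
    also have "\<dots> = (if L' = L then (\<Oplus>\<^bsub>?M\<^esub>M'\<in>?B. if M' = M then c L' M' else \<zero>\<^bsub>?M\<^esub>) else \<zero>\<^bsub>?M\<^esub>)"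
      by simp
    finally show "(\<Oplus>\<^bsub>?M\<^esub>M'\<in>?B. (RS_basis R (G \<times>\<times> H) L L' \<otimes>\<^bsub>R\<^esub> RS_basis R (H \<times>\<times> K) M M') \<odot>\<^bsub>?M\<^esub> c L' M')
        = (if L' = L then (\<Oplus>\<^bsub>?M\<^esub>M'\<in>?B. if M' = M then c L' M' else \<zero>\<^bsub>?M\<^esub>) else \<zero>\<^bsub>?M\<^esub>)" .
  qed (use c in \<open>auto intro!: GK.finsum_closed\<close>)
  also have "\<dots> = (\<Oplus>\<^bsub>?M\<^esub>M'\<in>?B. if M' = M then c L M' else \<zero>\<^bsub>?M\<^esub>)"
    by (rule GK.add.finprod_singleton_swap[OF L fin_subgroups(1), where f = "\<lambda>L'. \<Oplus>\<^bsub>?M\<^esub>M'\<in>?B. if M' = M then c L' M' else \<zero>\<^bsub>?M\<^esub>"])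
      (use c in \<open>auto intro!: GK.finsum_closed\<close>)
  also have "\<dots> = c L M"
    by (rule GK.add.finprod_singleton_swap[OF M fin_subgroups(2), where f = "c L"]) (use c in auto)
  finally show ?thesis by (simp add: c_def)
qed

text \<open>This is the theorem for classes of bisets. By bilinearity the left-hand side is the sum, over all
  pairs \<open>(x, y)\<close>, of the weighted star products of the two stabilizers. On an orbit \<open>P\<close> of pairs the
  star product is constant, namely the stabilizer of \<open>P\<close>, and the weight is constant as well: it is the
  order of the stabilizer of \<open>(x, y)\<close> in \<open>H\<close> divided by \<open>|H|\<close>, hence the inverse of \<open>|P|\<close> by the
  orbit-stabilizer theorem. So the pairs in \<open>P\<close> contribute the stabilizer of \<open>P\<close> exactly once. In the
  proof this weight is \<open>w P\<close>, with numerator \<open>|H| / |P|\<close> computed in the natural numbers, so that \<open>|P|\<close>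
  is never inverted in \<open>R\<close>.\<close>

lemma kappa_star_stab_sum:
  fixes X :: "('g, 'h, 'x) biset" and Y :: "('h, 'k, 'y) biset"
  assumes gr: "group G" "group H" "group K" and X: "biset G H X" and Y: "biset H K Y"
  shows "kappa_star R G H K (stab_sum R G H X) (stab_sum R H K Y) = stab_sum R G K (biset_prod H X Y)"
proof -
  interpret XY: biset_pair G H K X Y using gr X Y by (simp add: biset_pair_def)
  let ?M = "RS R (G \<times>\<times> K)"
  let ?e = "\<lambda>x. RS_basis R (G \<times>\<times> H) (biset_stab G H X x)"
  let ?f = "\<lambda>y. RS_basis R (H \<times>\<times> K) (biset_stab H K Y y)"
  let ?u = "inv\<^bsub>R\<^esub> ([order H] \<cdot>\<^bsub>R\<^esub> \<one>\<^bsub>R\<^esub>)"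
  define w where "w P = ([(order H div card P)] \<cdot>\<^bsub>R\<^esub> \<one>\<^bsub>R\<^esub>) \<otimes>\<^bsub>R\<^esub> ?u" for P :: "('x \<times> 'y) set"
  define e where "e P = RS_basis R (G \<times>\<times> K) (biset_stab G K (biset_prod H X Y) P)" for P
  have u: "?u \<in> carrier R" using unit by simp
  have w: "w P \<in> carrier R" for P using u by (simp add: w_def)
  have e: "e P \<in> carrier ?M" for P by (simp add: e_def RS_basis_closed[OF R])
  note bil = bilin_mapD[OF kappa_star_bilinear, simplified]
  note mR = module_RS[OF R]
  have orbit_finite: "finite P" "card P > 0" "card P dvd order H" if P: "P \<in> bset (biset_prod H X Y)" for P
  proof -
    obtain x y where xy: "x \<in> bset X" "y \<in> bset Y" "P = XY.orb x y"
      using P by (auto simp: XY.bset_biset_prod)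
    show "finite P"
      using finite_subset[OF XY.orb_subset[OF xy(1,2)]] XY.X.finite_bset XY.Y.finite_bset xy(3) by simp
    then show "card P > 0"
      using XY.orb_refl[OF xy(1,2)] xy(3) by (auto simp: card_gt_0_iff)
    show "card P dvd order H"
      using XY.card_orb_mult_card_stab[OF xy(1,2) fin(2)] xy(3) by (metis dvd_triv_left)
  qed
  \<comment> \<open>one pair: a multiple of a basis vector that depends only on the orbit of the pair\<close>
  have term_eq: "kappa_star R G H K (?e x) (?f y) = w (XY.orb x y) \<odot>\<^bsub>?M\<^esub> e (XY.orb x y)"
    if xy: "x \<in> bset X" "y \<in> bset Y" for x y
  proof -
    have "card (k2 G H (biset_stab G H X x) \<inter> k1 H K (biset_stab H K Y y)) = order H div card (XY.orb x y)"
      using XY.card_orb_mult_card_stab[OF xy fin(2)] orbit_finite(2)[OF XY.orb_closed[OF xy]]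
      by (metis nonzero_mult_div_cancel_left not_less0)
    then show ?thesis
      unfolding kappa_star_basis[OF biset_stab_subgroup[OF gr(1,2) X xy(1)] biset_stab_subgroup[OF gr(2,3) Y xy(2)]]
      by (simp add: kappa_def w_def e_def XY.biset_stab_biset_prod[OF xy])
  qed
  have "kappa_star R G H K (stab_sum R G H X) (stab_sum R H K Y)
      = (\<Oplus>\<^bsub>?M\<^esub>x\<in>bset X. kappa_star R G H K (?e x) (stab_sum R H K Y))"
    unfolding stab_sum_def[of R G H X]
    by (rule lin_map_finsum[OF mR mR bil(1)[OF stab_sum_closed[OF R gr(3)]] XY.X.finite_bset])
      (rule RS_basis_closed[OF R])
  also have "\<dots> = (\<Oplus>\<^bsub>?M\<^esub>x\<in>bset X. \<Oplus>\<^bsub>?M\<^esub>y\<in>bset Y. kappa_star R G H K (?e x) (?f y))"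
    unfolding stab_sum_def[of R H K Y]
    by (intro arg_cong[of _ _ "\<lambda>f. finsum ?M f (bset X)"] ext
        lin_map_finsum[OF mR mR bil(2)[OF RS_basis_closed[OF R]] XY.Y.finite_bset] RS_basis_closed[OF R])
  also have "\<dots> = (\<Oplus>\<^bsub>?M\<^esub>x\<in>bset X. \<Oplus>\<^bsub>?M\<^esub>y\<in>bset Y. w (XY.orb x y) \<odot>\<^bsub>?M\<^esub> e (XY.orb x y))"
    by (intro GK.finsum_cong' refl) (auto simp: term_eq w e intro!: GK.finsum_closed GK.finsum_cong')
  also have "\<dots> = (\<Oplus>\<^bsub>?M\<^esub>p\<in>bset X \<times> bset Y. case p of (x, y) \<Rightarrow> w (XY.orb x y) \<odot>\<^bsub>?M\<^esub> e (XY.orb x y))"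
    by (rule GK.finsum_Times) (simp_all add: XY.X.finite_bset XY.Y.finite_bset w e)
  also have "\<dots> = (\<Oplus>\<^bsub>?M\<^esub>P\<in>bset (biset_prod H X Y). \<Oplus>\<^bsub>?M\<^esub>p\<in>P. case p of (x, y) \<Rightarrow> w (XY.orb x y) \<odot>\<^bsub>?M\<^esub> e (XY.orb x y))"
    unfolding XY.Union_orbits[symmetric]
    by (rule GK.add.finprod_Union_disjoint)
      (auto simp: XY.disjoint_orbits orbit_finite(1) w e biset.finite_bset[OF XY.biset_biset_prod])
  also have "\<dots> = (\<Oplus>\<^bsub>?M\<^esub>P\<in>bset (biset_prod H X Y). e P)"
  proof (rule GK.finsum_cong')
    fix P assume P: "P \<in> bset (biset_prod H X Y)"
    have orb_P: "XY.orb x y = P" if "(x, y) \<in> P" for x y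
      using P that XY.orb_memD unfolding XY.bset_biset_prod by blast
    have "(\<Oplus>\<^bsub>?M\<^esub>p\<in>P. case p of (x, y) \<Rightarrow> w (XY.orb x y) \<odot>\<^bsub>?M\<^esub> e (XY.orb x y)) = (\<Oplus>\<^bsub>?M\<^esub>p\<in>P. w P \<odot>\<^bsub>?M\<^esub> e P)"
      by (rule GK.finsum_cong') (auto simp: orb_P w e)
    also have "\<dots> = ([card P] \<cdot>\<^bsub>R\<^esub> w P) \<odot>\<^bsub>?M\<^esub> e P"
      by (rule GK.finsum_const_smult[OF orbit_finite(1)[OF P] w e])
    also have "[card P] \<cdot>\<^bsub>R\<^esub> w P = ([(card P * (order H div card P))] \<cdot>\<^bsub>R\<^esub> \<one>\<^bsub>R\<^esub>) \<otimes>\<^bsub>R\<^esub> ?u"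
      using u by (simp add: w_def R.add_pow_ldistr R.add.nat_pow_pow mult.commute)
    also have "card P * (order H div card P) = order H"
      using orbit_finite(3)[OF P] by simp
    also have "([order H] \<cdot>\<^bsub>R\<^esub> \<one>\<^bsub>R\<^esub>) \<otimes>\<^bsub>R\<^esub> ?u = \<one>\<^bsub>R\<^esub>"
      using unit by simp
    finally show "(\<Oplus>\<^bsub>?M\<^esub>p\<in>P. case p of (x, y) \<Rightarrow> w (XY.orb x y) \<odot>\<^bsub>?M\<^esub> e (XY.orb x y)) = e P"
      by (simp add: e)
  qed (auto simp: e)
  finally show ?thesis by (simp add: stab_sum_def e_def)
qed

end

theorem proposition3p6:
  fixes G :: "('g, 'm) monoid_scheme" and H :: "('h, 'p) monoid_scheme"
    and K :: "('k, 'q) monoid_scheme" and R :: "('r, 'n) ring_scheme"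
  assumes "group G" and "finite (carrier G)"
    and "group H" and "finite (carrier H)"
    and "group K" and "finite (carrier K)"
    and "cring R" and "[order H] \<cdot>\<^bsub>R\<^esub> \<one>\<^bsub>R\<^esub> \<in> Units R"
    and "a \<in> carrier (RB R G H)" and "b \<in> carrier (RB R H K)"
  shows "alpha R G K (biset_comp R G H K a b)
           = kappa_star R G H K (alpha R G H a) (alpha R H K b)"
proof -
  note R = \<open>cring R\<close> and gr = \<open>group G\<close> \<open>group H\<close> \<open>group K\<close>
  note comp = biset_comp_spec[OF R gr]
  note aGH = alpha_spec[OF R \<open>group H\<close>, of G] and aHK = alpha_spec[OF R \<open>group K\<close>, of H]
    and aGK = alpha_spec[OF R \<open>group K\<close>, of G]
  note star = kappa_star_bilinear[OF R assms(8,2,4,6)]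
  have "(\<lambda>(a, b). alpha R G K (biset_comp R G H K a b)) (a, b)
      = (\<lambda>(a, b). kappa_star R G H K (alpha R G H a) (alpha R H K b)) (a, b)"
  proof (rule RB_bilin_map_eqI[OF R module_RS[OF R] _ _ _ assms(9,10)])
    show "bilin_map R (RB R G H) (RB R H K) (RS R (G \<times>\<times> K)) (\<lambda>(a, b). alpha R G K (biset_comp R G H K a b))"
      using lin_map_compose[OF bilin_mapD(1)[OF comp(1)] aGK(1)] lin_map_compose[OF bilin_mapD(2)[OF comp(1)] aGK(1)]
      by (simp add: bilin_map_def)
    show "bilin_map R (RB R G H) (RB R H K) (RS R (G \<times>\<times> K)) (\<lambda>(a, b). kappa_star R G H K (alpha R G H a) (alpha R H K b))"
      using lin_map_compose[OF aGH(1) bilin_mapD(1)[OF star]] lin_map_compose[OF aHK(1) bilin_mapD(2)[OF star]]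
        lin_mapD(1)[OF aGH(1)] lin_mapD(1)[OF aHK(1)]
      by (simp add: bilin_map_def)
    fix X :: "('g, 'h, nat) biset" and Y :: "('h, 'k, nat) biset"
    assume X: "biset G H X" and Y: "biset H K Y"
    have "biset G K (biset_prod H X Y)"
      by (rule biset_pair.biset_biset_prod) (use gr X Y in \<open>simp add: biset_pair_def\<close>)
    then show "(\<lambda>(a, b). alpha R G K (biset_comp R G H K a b)) (RB_class R G H X, RB_class R H K Y)
        = (\<lambda>(a, b). kappa_star R G H K (alpha R G H a) (alpha R H K b)) (RB_class R G H X, RB_class R H K Y)"
      by (simp add: comp(2)[OF X Y] aGH(2)[OF X] aHK(2)[OF Y] alpha_RB_class[OF R \<open>group K\<close>]
          kappa_star_stab_sum[OF R assms(8,2,4,6) gr X Y])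
  qed
  then show ?thesis by simp
qed

end
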